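(* For every nilradical $\mathfrak n$ in $\mathfrak{sl}_{n+1}$, there is a simple root $\alpha\in\Pi$ such that $\mathfrak n_{\{\alpha\}}\subset\mathfrak n\subset\widetilde{\mathfrak n_{\{\alpha\}}}$. Therefore, $\mathcal S(\mathfrak n)$ is a free module over $\mathcal S(\mathfrak n)^U$ for any nilradical $\mathfrak n$ in $\mathfrak{sl}_{n+1}$.
   Context: Everything is over $\mathbb C$. For $\mathfrak g=\mathfrak{sl}_{n+1}$, $\mathfrak b$ (resp. $\mathfrak u$) is the set of upper-triangular (resp. strictly upper-triangular) traceless matrices and $U=\exp(\mathfrak u)$; $\Delta^+=\{\varepsilon_i-\varepsilon_j\mid i<j\}$, simple roots $\Pi=\{\alpha_1,\dots,\alpha_n\}$, $\alpha_i=\varepsilon_i-\varepsilon_{i+1}$; $[\gamma:\alpha]$ is the coefficient of $\alpha\in\Pi$ in $\gamma$. For nonempty $\mathcal T\subset\Pi$, $\mathfrak n_{\mathcal T}=\bigoplus\mathfrak g_\gamma$, the sum over all $\gamma\in\Delta^+$ with $[\gamma:\alpha]>0$ for some $\alpha\in\mathcal T$; "nilradical" means a nonzero nilradical of a standard parabolic subalgebra, i.e. some $\mathfrak n_{\mathcal T}$. The Kostant cascade is $\mathcal K=\{\beta_1,\dots,\beta_t\}$, $t=[(n+1)/2]$, $\beta_i=\alpha_i+\dots+\alpha_{n+1-i}$, with $\Phi(\beta_i)=\{\alpha_i,\alpha_{n+1-i}\}$. The optimisation of $\mathfrak n$ is $\tilde{\mathfrak n}=\mathfrak n_{\tilde{\mathcal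 T}}$ with $\tilde{\mathcal T}=\bigcup_{\beta_i\in\mathcal K\cap\Delta(\mathfrak n)}\Phi(\beta_i)$, where $\Delta(\mathfrak n)$ is the set of roots of $\mathfrak n$. Since $\mathfrak n$ is $\mathfrak b$-stable, $U$ acts on the symmetric algebra $\mathcal S(\mathfrak n)$, and $\mathcal S(\mathfrak n)^U$ is the subalgebra of invariants. *)

theory Defs
  imports
    Complex_Main
    "HOL-Library.Poly_Mapping"
    "Jordan_Normal_Form.Gauss_Jordan_Elimination"
begin

section \<open>Roots of the special linear Lie algebra\<close>

text \<open>
  Weights are integer combinations of the \<open>\<epsilon>\<^sub>i\<close>, \<open>1 \<le> i \<le> n + 1\<close>. Indices of weights and roots
  start at 1, whereas the entries of a matrix are numbered from 0, so that \<open>\<epsilon>\<^sub>i\<close> reads off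
  the diagonal entry with index \<open>i - 1\<close>.
\<close>

type_synonym wt = "nat \<Rightarrow>\<^sub>0 int"

definition eps :: "nat \<Rightarrow> wt" where
  "eps i = Poly_Mapping.single i 1"

definition simple_root :: "nat \<Rightarrow> wt" where
  "simple_root i = eps i - eps (i + 1)"

definition simple_roots :: "nat \<Rightarrow> wt set" where
  "simple_roots n = simple_root ` {1..n}"

definition pos_roots :: "nat \<Rightarrow> wt set" where
  "pos_roots n = {eps i - eps j | i j. 1 \<le> i \<and> i < j \<and> j \<le> n + 1}"

text \<open>\<open>root_coeff n \<gamma> \<alpha>\<close> is \<open>[\<gamma> : \<alpha>]\<close>; it is meaningful for \<open>\<gamma>\<close> in the root lattice.\<close>

definition root_coeff :: "nat \<Rightarrow> wt \<Rightarrow> wt \<Rightarrow> int" where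
  "root_coeff n \<gamma> = (THE c. (\<forall>\<beta>. \<beta> \<notin> simple_roots n \<longrightarrow> c \<beta> = 0) \<and>
      \<gamma> = (\<Sum>\<beta>\<in>simple_roots n. frag_cmul (c \<beta>) \<beta>))"


section \<open>Nilradicals and their optimisations\<close>

definition sl :: "nat \<Rightarrow> complex mat set" where
  "sl n = {X \<in> carrier_mat (n + 1) (n + 1). (\<Sum>i<n + 1. X $$ (i, i)) = 0}"

definition cartan :: "nat \<Rightarrow> complex mat set" where
  "cartan n = {H \<in> sl n. diagonal_mat H}"

definition wt_eval :: "nat \<Rightarrow> wt \<Rightarrow> complex mat \<Rightarrow> complex" where
  "wt_eval n \<gamma> H = (\<Sum>i\<in>{1..n + 1}. of_int (Poly_Mapping.lookup \<gamma> i) * H $$ (i - 1, i - 1))"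

definition root_space :: "nat \<Rightarrow> wt \<Rightarrow> complex mat set" where
  "root_space n \<gamma> = {X \<in> sl n. \<forall>H\<in>cartan n. H * X - X * H = wt_eval n \<gamma> H \<cdot>\<^sub>m X}"

text \<open>
  Matrices of arbitrary size do not form an additive type, hence an explicit sum of a finite
  family of square matrices of size \<open>N\<close>.
\<close>

definition mat_sum :: "nat \<Rightarrow> ('i \<Rightarrow> complex mat) \<Rightarrow> 'i set \<Rightarrow> complex mat" where
  "mat_sum N X A = mat N N (\<lambda>p. \<Sum>a\<in>A. X a $$ p)"

definition nil_of :: "nat \<Rightarrow> wt set \<Rightarrow> complex mat set" where
  "nil_of n T =
     (let R = {\<gamma> \<in> pos_roots n. \<exists>\<alpha>\<in>T. root_coeff n \<gamma> \<alpha> > 0}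
      in {mat_sum (n + 1) X R | X. \<forall>\<gamma>\<in>R. X \<gamma> \<in> root_space n \<gamma>})"

definition nilradical :: "nat \<Rightarrow> complex mat set \<Rightarrow> bool" where
  "nilradical n N \<longleftrightarrow> (\<exists>T. T \<subseteq> simple_roots n \<and> T \<noteq> {} \<and> N = nil_of n T)"

definition roots_of :: "nat \<Rightarrow> complex mat set \<Rightarrow> wt set" where
  "roots_of n N = {\<gamma> \<in> pos_roots n. root_space n \<gamma> \<subseteq> N}"

definition cascade_root :: "nat \<Rightarrow> nat \<Rightarrow> wt" where
  "cascade_root n i = (\<Sum>k\<in>{i..n + 1 - i}. simple_root k)"

definition cascade_Phi :: "nat \<Rightarrow> nat \<Rightarrow> wt set" where
  "cascade_Phi n i = {simple_root i, simple_root (n + 1 - i)}"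

definition optimisation :: "nat \<Rightarrow> complex mat set \<Rightarrow> complex mat set" where
  "optimisation n N =
     nil_of n (\<Union>i\<in>{i \<in> {1..(n + 1) div 2}. cascade_root n i \<in> roots_of n N}. cascade_Phi n i)"


section \<open>The unipotent group\<close>

definition strict_upper :: "nat \<Rightarrow> complex mat set" where
  "strict_upper n = {X \<in> sl n. \<forall>i<n + 1. \<forall>j\<le>i. X $$ (i, j) = 0}"

definition mat_exp :: "complex mat \<Rightarrow> complex mat" where
  "mat_exp X = mat (dim_row X) (dim_row X) (\<lambda>p. suminf (\<lambda>k. (X ^\<^sub>m k) $$ p / fact k))"

definition unip :: "nat \<Rightarrow> complex mat set" where
  "unip n = mat_exp ` strict_upper n"

definition Ad :: "complex mat \<Rightarrow> complex mat \<Rightarrow> complex mat" where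
  "Ad g X = g * X * the (mat_inverse g)"


section \<open>The symmetric algebra of a nilradical\<close>

text \<open>
  The symmetric algebra of a space with a basis \<open>(e\<^sub>\<gamma>)\<close> is the polynomial algebra in
  variables \<open>x\<^sub>\<gamma>\<close>; here \<open>e\<^sub>\<gamma>\<close> is the matrix unit spanning the root space of \<open>\<gamma>\<close>. Polynomials are
  finitely supported functions on monomials, and monomials are finitely supported families of
  exponents.
\<close>

type_synonym spoly = "(wt \<Rightarrow>\<^sub>0 nat) \<Rightarrow>\<^sub>0 complex"

definition Cst :: "complex \<Rightarrow> spoly" where
  "Cst c = Poly_Mapping.single 0 c"

definition Var :: "wt \<Rightarrow> spoly" where
  "Var \<gamma> = Poly_Mapping.single (Poly_Mapping.single \<gamma> 1) 1"

definition Sym :: "nat \<Rightarrow> complex mat set \<Rightarrow> spoly set" where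
  "Sym n N = {p. \<forall>m\<in>Poly_Mapping.keys p. Poly_Mapping.keys m \<subseteq> roots_of n N}"

definition root_vector :: "nat \<Rightarrow> wt \<Rightarrow> complex mat" where
  "root_vector n \<gamma> = mat (n + 1) (n + 1) (\<lambda>(i, j). if \<gamma> = eps (i + 1) - eps (j + 1) then 1 else 0)"

text \<open>
  The linear inclusion of the strictly upper triangular matrices into polynomials, sending
  \<open>e\<^sub>\<gamma>\<close> to \<open>x\<^sub>\<gamma>\<close>.
\<close>

definition emb :: "nat \<Rightarrow> complex mat \<Rightarrow> spoly" where
  "emb n X = (\<Sum>i<n + 1. \<Sum>j<n + 1. Cst (X $$ (i, j)) * Var (eps (i + 1) - eps (j + 1)))"

definition poly_subst :: "(wt \<Rightarrow> spoly) \<Rightarrow> spoly \<Rightarrow> spoly" where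
  "poly_subst f p = (\<Sum>m\<in>Poly_Mapping.keys p.
     Cst (Poly_Mapping.lookup p m) * (\<Prod>\<gamma>\<in>Poly_Mapping.keys m. f \<gamma> ^ Poly_Mapping.lookup m \<gamma>))"

text \<open>The algebra endomorphism that extends \<open>Ad g\<close> from the strictly upper triangular matrices
  (on which \<open>act n g (emb n X) = emb n (Ad g X)\<close> for \<open>g\<close> in \<open>unip n\<close>). It maps
  \<open>Sym n N\<close> to itself for every nilradical \<open>N\<close>, as \<open>N\<close> is stable under \<open>Ad\<close>.\<close>

definition act :: "nat \<Rightarrow> complex mat \<Rightarrow> spoly \<Rightarrow> spoly" where
  "act n g = poly_subst (\<lambda>\<gamma>. emb n (Ad g (root_vector n \<gamma>)))"

definition Sym_inv :: "nat \<Rightarrow> complex mat set \<Rightarrow> spoly set" where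
  "Sym_inv n N = {p \<in> Sym n N. \<forall>g\<in>unip n. act n g p = p}"


section \<open>Free modules over a subring\<close>

text \<open>
  \<open>M\<close> is a free module over the subring \<open>R\<close> of an ambient commutative ring that contains \<open>M\<close>,
  with multiplication of the ambient ring as scalar multiplication: it has a basis \<open>B\<close>,
  possibly infinite.
\<close>

definition free_over :: "'a::comm_ring_1 set \<Rightarrow> 'a set \<Rightarrow> bool" where
  "free_over R M \<longleftrightarrow> (\<exists>B\<subseteq>M.
     M = {\<Sum>b\<in>F. c b * b | F c. finite F \<and> F \<subseteq> B \<and> (\<forall>b\<in>F. c b \<in> R)} \<and>
     (\<forall>F c. finite F \<and> F \<subseteq> B \<and> (\<forall>b\<in>F. c b \<in> R) \<and> (\<Sum>b\<in>F. c b * b) = 0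
        \<longrightarrow> (\<forall>b\<in>F. c b = 0)))"

end

theory Submission
  imports Defs "HOL-Computational_Algebra.Polynomial" "Jordan_Normal_Form.Determinant"
begin

text \<open>
  Let \<open>\<T>\<close> define \<open>\<nn>\<close>, and let \<open>\<alpha>\<^sub>k \<in> \<T>\<close> be as close as possible to the middle of the Dynkin diagram; put
  \<open>m = min k (n + 1 - k)\<close>. Every root of \<open>\<nn>\<close> lies in one of the first \<open>m\<close> rows or the last \<open>m\<close>
  columns, and \<open>\<nn>\<close> contains the whole \<open>m \<times> m\<close> block in the upper right corner.
  The corner minors \<open>f\<^sub>1, \<dots>, f\<^sub>m\<close> of the generic matrix are invariant under \<open>U\<close>.

  \<^item> The diagonal monomials of \<open>f\<^sub>1, \<dots>, f\<^sub>m\<close> (those with all factors of equal height) are the unique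
    terms of least weight, for a suitable weight of the variables, and they involve disjoint sets
    of variables. Hence the products of powers of the \<open>f\<^sub>i\<close> with one monomial divisible by no
    diagonal monomial are triangular with respect to the monomials. So \<open>\<S>(\<nn>)\<close> is free over
    \<open>\<complex>[f\<^sub>1, \<dots>, f\<^sub>m]\<close>, with a basis that contains \<open>1\<close>.
  \<^item> Gaussian elimination moves a generic point of \<open>\<nn>\<^sup>*\<close> by \<open>U\<close> to an antidiagonal one, whose entries are
    quotients of consecutive minors. So an invariant becomes a polynomial in the \<open>f\<^sub>i\<close> after
    multiplication by a product of the \<open>f\<^sub>i\<close>, and by freeness it was one before. Thus
    \<open>\<S>(\<nn>)\<^sup>U = \<complex>[f\<^sub>1, \<dots>, f\<^sub>m]\<close>.
\<close>

section \<open>Evaluation of polynomials\<close>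

definition mon_eval :: "('v \<Rightarrow> 'a::comm_ring_1) \<Rightarrow> ('v \<Rightarrow>\<^sub>0 nat) \<Rightarrow> 'a" where
  "mon_eval v m = (\<Prod>x\<in>Poly_Mapping.keys m. v x ^ Poly_Mapping.lookup m x)"

text \<open>Identities between polynomials are checked at all points; there a substitution, and so
  the group action, becomes a motion of the point (\<open>pev_poly_subst\<close>).\<close>

definition pev :: "('v \<Rightarrow> 'a::comm_ring_1) \<Rightarrow> (('v \<Rightarrow>\<^sub>0 nat) \<Rightarrow>\<^sub>0 'a) \<Rightarrow> 'a" where
  "pev v p = (\<Sum>m\<in>Poly_Mapping.keys p. Poly_Mapping.lookup p m * mon_eval v m)"

lemma mon_eval_superset:
  assumes "finite S" "Poly_Mapping.keys m \<subseteq> S"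
  shows "mon_eval v m = (\<Prod>x\<in>S. v x ^ Poly_Mapping.lookup m x)"
  unfolding mon_eval_def using assms
  by (intro prod.mono_neutral_left) (auto simp: in_keys_iff)

lemma mon_eval_add: "mon_eval v (m + m') = mon_eval v m * mon_eval v m'"
proof -
  let ?S = "Poly_Mapping.keys m \<union> Poly_Mapping.keys m'"
  have "Poly_Mapping.keys (m + m') \<subseteq> ?S"
    by (rule keys_add)
  then show ?thesis
    by (simp add: mon_eval_superset[of ?S] lookup_add power_add prod.distrib)
qed

lemma mon_eval_0 [simp]: "mon_eval v 0 = 1"
  by (simp add: mon_eval_def)

lemma mon_eval_single [simp]: "mon_eval v (Poly_Mapping.single x k) = v x ^ k"
  by (cases "k = 0") (auto simp: mon_eval_def)

lemma pev_superset:
  assumes "finite S" "Poly_Mapping.keys p \<subseteq> S"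
  shows "pev v p = (\<Sum>m\<in>S. Poly_Mapping.lookup p m * mon_eval v m)"
  unfolding pev_def using assms
  by (intro sum.mono_neutral_left) (auto simp: in_keys_iff)

lemma pev_0 [simp]: "pev v 0 = 0"
  by (simp add: pev_def)

lemma pev_add: "pev v (p + q) = pev v p + pev v q"
proof -
  let ?S = "Poly_Mapping.keys p \<union> Poly_Mapping.keys q"
  have "Poly_Mapping.keys (p + q) \<subseteq> ?S"
    by (rule keys_add)
  then show ?thesis
    by (simp add: pev_superset[of ?S] lookup_add algebra_simps sum.distrib)
qed

lemma pev_sum: "pev v (\<Sum>x\<in>X. f x) = (\<Sum>x\<in>X. pev v (f x))"
  by (induction X rule: infinite_finite_induct) (auto simp: pev_add)

lemma pev_single [simp]: "pev v (Poly_Mapping.single m c) = c * mon_eval v m"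
  by (cases "c = 0") (auto simp: pev_def)

lemma sum_monomials:
  "(\<Sum>m\<in>Poly_Mapping.keys p. Poly_Mapping.single m (Poly_Mapping.lookup p m)) = p"
  by (rule poly_mapping_eqI)
    (auto simp: lookup_sum lookup_single when_def in_keys_iff sum.delta)

lemma pev_mult: "pev v (p * q) = pev v p * pev v q"
proof -
  have "pev v (p * q) = pev v ((\<Sum>m\<in>Poly_Mapping.keys p. Poly_Mapping.single m (Poly_Mapping.lookup p m)) *
      (\<Sum>m\<in>Poly_Mapping.keys q. Poly_Mapping.single m (Poly_Mapping.lookup q m)))"
    by (simp only: sum_monomials)
  also have "\<dots> = pev v p * pev v q"
    unfolding sum_product pev_sum mult_single pev_single mon_eval_add
    by (simp add: sum_product pev_def algebra_simps)
  finally show ?thesis .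
qed

lemma pev_1 [simp]: "pev v 1 = 1"
  by (simp flip: single_one)

lemma comm_ring_hom_pev: "comm_ring_hom (pev v)"
  by unfold_locales (auto simp: pev_add pev_mult)

lemma pev_power: "pev v (p ^ k) = pev v p ^ k"
  by (induction k) (auto simp: pev_mult)

lemma pev_prod: "pev v (\<Prod>x\<in>X. f x) = (\<Prod>x\<in>X. pev v (f x))"
  by (induction X rule: infinite_finite_induct) (auto simp: pev_mult)

lemma pev_diff: "pev v (p - q) = pev v p - pev v q"
  using pev_add[of v "p - q" q] by simp

lemma pev_Cst [simp]: "pev v (Cst c) = c"
  by (simp add: Cst_def)

lemma pev_Var [simp]: "pev v (Var x) = v x"
  by (simp add: Var_def)

lemma pev_poly_subst: "pev v (poly_subst f p) = pev (\<lambda>x. pev v (f x)) p"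
  by (simp add: poly_subst_def pev_sum pev_mult pev_prod pev_power pev_def[of _ p] mon_eval_def)

lemma pev_cong:
  assumes "\<And>m x. m \<in> Poly_Mapping.keys p \<Longrightarrow> x \<in> Poly_Mapping.keys m \<Longrightarrow> v x = v' x"
  shows "pev v p = pev v' p"
  unfolding pev_def mon_eval_def using assms by (intro sum.cong prod.cong arg_cong2[where f = "(*)"]) auto

text \<open>Induction on the variables: with all of them but \<open>y\<close> frozen, the sum is a
  univariate polynomial that vanishes everywhere, so each of its coefficients is 0. Exponents are
  plain functions and only their values on \<open>V\<close> enter, hence \<open>M\<close> has to be
  separated by these values.\<close>

lemma coeffs_zero_if_evals_zero:
  fixes c :: "('v \<Rightarrow> nat) \<Rightarrow> 'a::{idom,ring_char_0}"
  assumes "finite V" "finite M" "inj_on (\<lambda>m. restrict m V) M"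
    and "\<And>v. (\<Sum>m\<in>M. c m * (\<Prod>x\<in>V. v x ^ m x)) = 0" "m \<in> M"
  shows "c m = 0"
  using assms
proof (induction V arbitrary: M m rule: finite_induct)
  case empty
  \<comment> \<open>Without variables all restrictions coincide, so injectivity leaves a single
    exponent.\<close>
  have "M = {m}"
    using empty.prems(2,4) by (auto simp: inj_on_def restrict_def)
  then show ?case
    using empty.prems(3) by simp
next
  case (insert y V)
  \<comment> \<open>The terms that contribute to the coefficient of degree \<open>m y\<close> in the
    variable \<open>y\<close>.\<close>
  define K where "K = {m' \<in> M. m' y = m y}"
  have "(\<Sum>m\<in>K. c m * (\<Prod>x\<in>V. v x ^ m x)) = 0" for v
  proof -
    define q :: "'a poly" where "q = (\<Sum>m\<in>M. monom (c m * (\<Prod>x\<in>V. v x ^ m x)) (m y))"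
    have "poly q t = 0" for t
    proof -
      have "poly q t = (\<Sum>m\<in>M. c m * (\<Prod>x\<in>insert y V. (v(y := t)) x ^ m x))"
        unfolding q_def poly_sum
      proof (rule sum.cong[OF refl])
        fix m
        have "(\<Prod>x\<in>V. (v(y := t)) x ^ m x) = (\<Prod>x\<in>V. v x ^ m x)"
          using insert.hyps by (intro prod.cong) auto
        then show "poly (monom (c m * (\<Prod>x\<in>V. v x ^ m x)) (m y)) t
            = c m * (\<Prod>x\<in>insert y V. (v(y := t)) x ^ m x)"
          using insert.hyps by (simp add: poly_monom algebra_simps)
      qed
      then show ?thesis
        using insert.prems(3) by simp
    qed
    then have "q = 0"
      using poly_all_0_iff_0 by blast
    then have "coeff q (m y) = 0"
      by simp
    then show ?thesis
      unfolding q_def K_def coeff_sum using insert.prems(1)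
      by (simp add: sum.inter_filter)
  qed
  moreover have "inj_on (\<lambda>m. restrict m V) K"
  proof (rule inj_onI)
    fix m1 m2
    assume *: "m1 \<in> K" "m2 \<in> K" "restrict m1 V = restrict m2 V"
    have "m1 x = m2 x" if "x \<in> V" for x
      using fun_cong[OF *(3), of x] that by simp
    then have "restrict m1 (insert y V) = restrict m2 (insert y V)"
      using *(1,2) by (auto simp: K_def restrict_def)
    then show "m1 = m2"
      using *(1,2) inj_onD[OF insert.prems(2)] by (simp only: K_def mem_Collect_eq)
  qed
  moreover have "finite K" "m \<in> K"
    using insert.prems by (auto simp: K_def)
  ultimately show ?case
    using insert.IH by blast
qed

lemma poly_eqI_pev:
  fixes p q :: "('v \<Rightarrow>\<^sub>0 nat) \<Rightarrow>\<^sub>0 'a::{idom,ring_char_0}"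
  assumes "\<And>v. pev v p = pev v q"
  shows "p = q"
proof -
  define d where "d = p - q"
  define V where "V = (\<Union>m\<in>Poly_Mapping.keys d. Poly_Mapping.keys m)"
  define M where "M = Poly_Mapping.lookup ` Poly_Mapping.keys d"
  have fin: "finite V" "finite M"
    by (auto simp: V_def M_def)
  have inj: "inj_on Poly_Mapping.lookup (Poly_Mapping.keys d)"
    by (rule inj_onI) (simp only: lookup_inject)
  \<comment> \<open>\<open>Abs_poly_mapping\<close> recovers a monomial from its exponent function,
    the form in which \<open>coeffs_zero_if_evals_zero\<close> takes exponents.\<close>
  define c where "c f = Poly_Mapping.lookup d (Abs_poly_mapping f)" for f
  have "inj_on (\<lambda>m. restrict m V) M"
  proof (rule inj_onI)
    fix f g
    assume *: "f \<in> M" "g \<in> M" "restrict f V = restrict g V"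
    show "f = g"
    proof (rule ext)
      fix x
      show "f x = g x"
      proof (cases "x \<in> V")
        case True
        then show ?thesis
          using fun_cong[OF *(3), of x] by simp
      next
        case False
        then show ?thesis
          using *(1,2) by (auto simp: M_def V_def in_keys_iff)
      qed
    qed
  qed
  moreover have "(\<Sum>m\<in>M. c m * (\<Prod>x\<in>V. v x ^ m x)) = 0" for v
  proof -
    have "pev v d = 0"
      using assms pev_diff[of v p q] by (simp add: d_def)
    moreover have "pev v d = (\<Sum>m\<in>M. c m * (\<Prod>x\<in>V. v x ^ m x))"
      unfolding M_def sum.reindex[OF inj] pev_def
      using fin by (auto simp: c_def V_def intro!: sum.cong mon_eval_superset arg_cong2[where f = "(*)"])
    ultimately show ?thesis
      by simp
  qed
  ultimately have "c f = 0" if "f \<in> M" for f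
    using coeffs_zero_if_evals_zero[OF fin] that by blast
  then have "Poly_Mapping.lookup d m = 0" if "m \<in> Poly_Mapping.keys d" for m
    using that by (metis M_def c_def imageI poly_mapping.lookup_inverse)
  then have "d = 0"
    by (intro poly_mapping_eqI) (auto simp: in_keys_iff)
  then show ?thesis
    by (simp add: d_def)
qed


section \<open>Initial monomials for a weight\<close>

text \<open>With \<open>w\<close> constantly 1 this is the total degree.\<close>

definition wgt :: "('v \<Rightarrow> nat) \<Rightarrow> ('v \<Rightarrow>\<^sub>0 nat) \<Rightarrow> nat" where
  "wgt w m = (\<Sum>x\<in>Poly_Mapping.keys m. w x * Poly_Mapping.lookup m x)"

lemma wgt_superset:
  assumes "finite S" "Poly_Mapping.keys m \<subseteq> S"
  shows "wgt w m = (\<Sum>x\<in>S. w x * Poly_Mapping.lookup m x)"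
  unfolding wgt_def using assms
  by (intro sum.mono_neutral_left) (auto simp: in_keys_iff)

lemma wgt_add: "wgt w (m + m') = wgt w m + wgt w m'"
proof -
  let ?S = "Poly_Mapping.keys m \<union> Poly_Mapping.keys m'"
  have "Poly_Mapping.keys (m + m') \<subseteq> ?S"
    by (rule keys_add)
  then show ?thesis
    by (simp add: wgt_superset[of ?S] lookup_add algebra_simps sum.distrib)
qed

lemma wgt_0 [simp]: "wgt w 0 = 0"
  by (simp add: wgt_def)

lemma wgt_single [simp]: "wgt w (Poly_Mapping.single x k) = w x * k"
  by (cases "k = 0") (auto simp: wgt_def)

lemma wgt_sum: "wgt w (\<Sum>x\<in>X. f x) = (\<Sum>x\<in>X. wgt w (f x))"
  by (induction X rule: infinite_finite_induct) (auto simp: wgt_add)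

section \<open>Polynomials in a given set of variables\<close>

definition polys_in :: "'v set \<Rightarrow> (('v \<Rightarrow>\<^sub>0 nat) \<Rightarrow>\<^sub>0 'a::zero) set" where
  "polys_in V = {p. \<forall>m\<in>Poly_Mapping.keys p. Poly_Mapping.keys m \<subseteq> V}"

lemma polys_in_0 [simp]: "0 \<in> polys_in V"
  by (simp add: polys_in_def)

lemma polys_in_single: "Poly_Mapping.keys m \<subseteq> V \<Longrightarrow> Poly_Mapping.single m c \<in> polys_in V"
  by (simp add: polys_in_def)

lemma polys_in_1 [simp]: "(1 :: ('v \<Rightarrow>\<^sub>0 nat) \<Rightarrow>\<^sub>0 'a::zero_neq_one) \<in> polys_in V"
  by (simp add: polys_in_def)

lemma polys_in_Cst [simp]: "Cst c \<in> polys_in V"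
  by (simp add: Cst_def polys_in_single)

lemma polys_in_Var [simp]: "x \<in> V \<Longrightarrow> Var x \<in> polys_in V"
  by (simp add: Var_def polys_in_single)

lemma polys_in_add:
  fixes p q :: "('v \<Rightarrow>\<^sub>0 nat) \<Rightarrow>\<^sub>0 'a::monoid_add"
  shows "p \<in> polys_in V \<Longrightarrow> q \<in> polys_in V \<Longrightarrow> p + q \<in> polys_in V"
  using keys_add[of p q] by (fastforce simp: polys_in_def)

lemma polys_in_uminus:
  fixes p :: "('v \<Rightarrow>\<^sub>0 nat) \<Rightarrow>\<^sub>0 'a::ab_group_add"
  shows "p \<in> polys_in V \<Longrightarrow> - p \<in> polys_in V"
  by (simp add: polys_in_def in_keys_iff)

lemma polys_in_diff:
  fixes p q :: "('v \<Rightarrow>\<^sub>0 nat) \<Rightarrow>\<^sub>0 'a::ab_group_add"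
  shows "p \<in> polys_in V \<Longrightarrow> q \<in> polys_in V \<Longrightarrow> p - q \<in> polys_in V"
  using polys_in_add[of p V "- q"] polys_in_uminus[of q V] by simp

lemma polys_in_mult:
  fixes p q :: "('v \<Rightarrow>\<^sub>0 nat) \<Rightarrow>\<^sub>0 'a::semiring_0"
  assumes "p \<in> polys_in V" "q \<in> polys_in V"
  shows "p * q \<in> polys_in V"
  unfolding polys_in_def
proof (intro CollectI ballI)
  fix m
  assume "m \<in> Poly_Mapping.keys (p * q)"
  then obtain a b where "m = a + b" "a \<in> Poly_Mapping.keys p" "b \<in> Poly_Mapping.keys q"
    using keys_mult[of p q] by blast
  then show "Poly_Mapping.keys m \<subseteq> V"
    using keys_add[of a b] assms unfolding polys_in_def by blast
qed

lemma polys_in_sum: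
  fixes f :: "'i \<Rightarrow> ('v \<Rightarrow>\<^sub>0 nat) \<Rightarrow>\<^sub>0 'a::comm_monoid_add"
  shows "(\<And>x. x \<in> X \<Longrightarrow> f x \<in> polys_in V) \<Longrightarrow> (\<Sum>x\<in>X. f x) \<in> polys_in V"
  by (induction X rule: infinite_finite_induct) (auto intro: polys_in_add)

lemma polys_in_prod:
  fixes f :: "'i \<Rightarrow> ('v \<Rightarrow>\<^sub>0 nat) \<Rightarrow>\<^sub>0 'a::comm_semiring_1"
  shows "(\<And>x. x \<in> X \<Longrightarrow> f x \<in> polys_in V) \<Longrightarrow> (\<Prod>x\<in>X. f x) \<in> polys_in V"
  by (induction X rule: infinite_finite_induct) (auto intro: polys_in_mult)

lemma polys_in_power:
  fixes p :: "('v \<Rightarrow>\<^sub>0 nat) \<Rightarrow>\<^sub>0 'a::comm_semiring_1"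
  shows "p \<in> polys_in V \<Longrightarrow> p ^ k \<in> polys_in V"
  by (induction k) (auto intro: polys_in_mult)

text \<open>All monomials of a fixed degree in finitely many variables have bounded weight, so an
  induction that moves to \<open>higher\<close> monomials ends.\<close>

definition higher :: "('v \<Rightarrow> nat) \<Rightarrow> ('v \<Rightarrow>\<^sub>0 nat) \<Rightarrow> ('v \<Rightarrow>\<^sub>0 nat) set" where
  "higher w t = {m. wgt (\<lambda>_. 1) m = wgt (\<lambda>_. 1) t \<and> wgt w t < wgt w m}"

text \<open>The monomial \<open>t\<close> is the unique one of least weight in \<open>p\<close>. As
  \<open>higher\<close> also fixes the degree, \<open>p\<close> is homogeneous.\<close>

definition has_initial :: "('v \<Rightarrow> nat) \<Rightarrow> ('v \<Rightarrow>\<^sub>0 nat) \<Rightarrow> (('v \<Rightarrow>\<^sub>0 nat) \<Rightarrow>\<^sub>0 'a::field) \<Rightarrow> bool" where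
  "has_initial w t p \<longleftrightarrow> (\<exists>c q. c \<noteq> 0 \<and> p = Poly_Mapping.single t c + q \<and> Poly_Mapping.keys q \<subseteq> higher w t)"

lemma has_initial_single: "c \<noteq> 0 \<Longrightarrow> has_initial w t (Poly_Mapping.single t c)"
  unfolding has_initial_def by (rule exI[of _ c], rule exI[of _ 0]) simp

lemma higher_add:
  assumes "a \<in> insert s (higher w s)" "b \<in> insert t (higher w t)" "a \<noteq> s \<or> b \<noteq> t"
  shows "a + b \<in> higher w (s + t)"
  using assms by (auto simp: higher_def wgt_add)

text \<open>Weights and degrees are additive, so among the products of a term of \<open>p\<close>
  with a term of \<open>q\<close> all but that of the two initial terms are strictly higher.\<close>

lemma has_initial_mult:
  assumes "has_initial w s p" "has_initial w t q"
  shows "has_initial w (s + t) (p * q)"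
proof -
  obtain c p' where p: "c \<noteq> 0" "p = Poly_Mapping.single s c + p'" "Poly_Mapping.keys p' \<subseteq> higher w s"
    using assms(1) by (auto simp: has_initial_def)
  obtain d q' where q: "d \<noteq> 0" "q = Poly_Mapping.single t d + q'" "Poly_Mapping.keys q' \<subseteq> higher w t"
    using assms(2) by (auto simp: has_initial_def)
  have irrefl: "s \<notin> higher w s" "t \<notin> higher w t"
    by (auto simp: higher_def)
  define r where "r = Poly_Mapping.single s c * q' + p' * Poly_Mapping.single t d + p' * q'"
  have "Poly_Mapping.keys (Poly_Mapping.single s c * q') \<subseteq> higher w (s + t)"
  proof
    fix m assume "m \<in> Poly_Mapping.keys (Poly_Mapping.single s c * q')"
    then obtain b where "m = s + b" "b \<in> Poly_Mapping.keys q'"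
      using keys_mult[of "Poly_Mapping.single s c" q'] p(1) by auto
    then show "m \<in> higher w (s + t)"
      using q(3) irrefl by (auto intro!: higher_add)
  qed
  moreover have "Poly_Mapping.keys (p' * Poly_Mapping.single t d) \<subseteq> higher w (s + t)"
  proof
    fix m assume "m \<in> Poly_Mapping.keys (p' * Poly_Mapping.single t d)"
    then obtain a where "m = a + t" "a \<in> Poly_Mapping.keys p'"
      using keys_mult[of p' "Poly_Mapping.single t d"] q(1) by auto
    then show "m \<in> higher w (s + t)"
      using p(3) irrefl by (auto intro!: higher_add)
  qed
  moreover have "Poly_Mapping.keys (p' * q') \<subseteq> higher w (s + t)"
  proof
    fix m assume "m \<in> Poly_Mapping.keys (p' * q')"
    then obtain a b where "m = a + b" "a \<in> Poly_Mapping.keys p'" "b \<in> Poly_Mapping.keys q'"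
      using keys_mult[of p' q'] by auto
    then show "m \<in> higher w (s + t)"
      using p(3) q(3) irrefl by (auto intro!: higher_add)
  qed
  ultimately have "Poly_Mapping.keys r \<subseteq> higher w (s + t)"
    unfolding r_def
    using keys_add[of "Poly_Mapping.single s c * q' + p' * Poly_Mapping.single t d" "p' * q'"]
      keys_add[of "Poly_Mapping.single s c * q'" "p' * Poly_Mapping.single t d"] by blast
  moreover have "p * q = Poly_Mapping.single (s + t) (c * d) + r"
    by (simp add: p(2) q(2) r_def algebra_simps mult_single)
  ultimately show ?thesis
    unfolding has_initial_def using p(1) q(1)
    by (intro exI[of _ "c * d"] exI[of _ r]) simp
qed

lemma has_initial_1 [simp]: "has_initial w 0 1"
  using has_initial_single[of 1 w 0] by simp

lemma has_initial_power:
  assumes "has_initial w t p"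
  shows "has_initial w (\<Sum>j<k. t) (p ^ k)"
proof (induction k)
  case (Suc k)
  then show ?case
    using has_initial_mult[OF Suc assms] by (simp add: mult.commute)
qed simp

lemma has_initial_prod:
  "(\<And>x. x \<in> X \<Longrightarrow> has_initial w (t x) (p x)) \<Longrightarrow> has_initial w (\<Sum>x\<in>X. t x) (\<Prod>x\<in>X. p x)"
  by (induction X rule: infinite_finite_induct) (auto intro: has_initial_mult)

lemma has_initial_lookup:
  assumes "has_initial w t p"
  shows "Poly_Mapping.lookup p t \<noteq> 0"
    and "Poly_Mapping.lookup p m \<noteq> 0 \<Longrightarrow> m = t \<or> wgt w t < wgt w m"
proof -
  obtain c q where cq: "c \<noteq> 0" "p = Poly_Mapping.single t c + q" "Poly_Mapping.keys q \<subseteq> higher w t"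
    using assms by (auto simp: has_initial_def)
  have zero: "Poly_Mapping.lookup q m = 0" if "m \<notin> higher w t" for m
    using cq(3) that by (auto simp: in_keys_iff)
  show "Poly_Mapping.lookup p t \<noteq> 0"
    using cq(1) zero[of t] by (simp add: cq(2) lookup_add higher_def)
  show "m = t \<or> wgt w t < wgt w m" if "Poly_Mapping.lookup p m \<noteq> 0"
    using that zero[of m] by (auto simp: cq(2) lookup_add lookup_single higher_def when_def split: if_splits)
qed

section \<open>Complex spans of families with prescribed initial monomials\<close>

lemma lookup_Cst_mult: "Poly_Mapping.lookup (Cst c * p) m = c * Poly_Mapping.lookup p m"
  unfolding Cst_def
  by (simp flip: mult_map_scale_conv_mult add: Poly_Mapping.map.rep_eq when_def)

definition comb :: "('i \<Rightarrow> spoly) \<Rightarrow> 'i set \<Rightarrow> spoly set" where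
  "comb P I = {\<Sum>x\<in>X. Cst (c x) * P x | X c. finite X \<and> X \<subseteq> I}"

lemma Cst_hom [simp]: "Cst 0 = 0" "Cst 1 = 1" "Cst (a + b) = Cst a + Cst b" "Cst (a * b) = Cst a * Cst b"
  by (simp_all add: Cst_def single_add mult_single)

lemma comb_add:
  assumes "p \<in> comb P I" "q \<in> comb P I"
  shows "p + q \<in> comb P I"
proof -
  obtain X c where X: "finite X" "X \<subseteq> I" "p = (\<Sum>x\<in>X. Cst (c x) * P x)"
    using assms(1) by (auto simp: comb_def)
  obtain Y d where Y: "finite Y" "Y \<subseteq> I" "q = (\<Sum>x\<in>Y. Cst (d x) * P x)"
    using assms(2) by (auto simp: comb_def)
  define e where "e x = (if x \<in> X then c x else 0) + (if x \<in> Y then d x else 0)" for x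
  have "p = (\<Sum>x\<in>X \<union> Y. Cst (if x \<in> X then c x else 0) * P x)"
    unfolding X(3) using X(1) Y(1) by (intro sum.mono_neutral_cong_left) auto
  moreover have "q = (\<Sum>x\<in>X \<union> Y. Cst (if x \<in> Y then d x else 0) * P x)"
    unfolding Y(3) using X(1) Y(1) by (intro sum.mono_neutral_cong_left) auto
  ultimately have "p + q = (\<Sum>x\<in>X \<union> Y. Cst (e x) * P x)"
    by (simp only: e_def Cst_hom distrib_right sum.distrib)
  then show ?thesis
    unfolding comb_def using X(1,2) Y(1,2) by blast
qed

lemma comb_0: "0 \<in> comb P I"
  unfolding comb_def by (rule CollectI, rule exI[of _ "{}"]) simp

lemma comb_base: "x \<in> I \<Longrightarrow> P x \<in> comb P I"
  unfolding comb_def by (rule CollectI, rule exI[of _ "{x}"], rule exI[of _ "\<lambda>_. 1"]) simp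

lemma comb_scale:
  assumes "p \<in> comb P I"
  shows "Cst a * p \<in> comb P I"
proof -
  obtain X c where X: "finite X" "X \<subseteq> I" "p = (\<Sum>x\<in>X. Cst (c x) * P x)"
    using assms(1) by (auto simp: comb_def)
  have "Cst a * p = (\<Sum>x\<in>X. Cst (a * c x) * P x)"
    by (simp add: X(3) sum_distrib_left mult.assoc)
  then show ?thesis
    unfolding comb_def using X(1,2)
    by (intro CollectI exI[of _ X] exI[of _ "\<lambda>x. a * c x"] conjI)
qed

lemma comb_sum: "(\<And>x. x \<in> X \<Longrightarrow> f x \<in> comb P I) \<Longrightarrow> (\<Sum>x\<in>X. f x) \<in> comb P I"
  by (induction X rule: infinite_finite_induct) (auto intro: comb_add comb_0)

text \<open>Among the members with nonzero coefficient choose one whose initial monomial has least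
  weight. This monomial occurs in no other of them: it is not their initial monomial by injectivity,
  and their other monomials are too heavy.\<close>

lemma initial_independent:
  assumes "finite X" "inj_on \<phi> X" "\<And>x. x \<in> X \<Longrightarrow> has_initial w (\<phi> x) (P x)"
    and "(\<Sum>x\<in>X. Cst (c x) * P x) = 0"
  shows "\<forall>x\<in>X. c x = 0"
proof (rule ccontr)
  define Y where "Y = {x \<in> X. c x \<noteq> 0}"
  assume "\<not> (\<forall>x\<in>X. c x = 0)"
  then have "Y \<noteq> {}"
    by (auto simp: Y_def)
  moreover have finY: "finite Y"
    using assms(1) by (simp add: Y_def)
  ultimately obtain y where "y \<in> Y" "wgt w (\<phi> y) = Min ((\<lambda>x. wgt w (\<phi> x)) ` Y)"
    using Min_in[of "(\<lambda>x. wgt w (\<phi> x)) ` Y"] by fastforce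
  then have y: "y \<in> Y" "\<And>x. x \<in> Y \<Longrightarrow> wgt w (\<phi> y) \<le> wgt w (\<phi> x)"
    using finY by auto
  have other: "c x * Poly_Mapping.lookup (P x) (\<phi> y) = 0" if "x \<in> X - {y}" for x
    using that y has_initial_lookup(2)[OF assms(3)[of x], of "\<phi> y"] assms(2)
    by (fastforce simp: Y_def inj_on_def)
  have "(\<Sum>x\<in>X. c x * Poly_Mapping.lookup (P x) (\<phi> y)) = c y * Poly_Mapping.lookup (P y) (\<phi> y)"
  proof -
    have "(\<Sum>x\<in>X - {y}. c x * Poly_Mapping.lookup (P x) (\<phi> y)) = 0"
      by (rule sum.neutral) (blast intro: other)
    then show ?thesis
      using assms(1) y(1) by (simp add: sum.remove[of X y] Y_def)
  qed
  moreover have "(\<Sum>x\<in>X. c x * Poly_Mapping.lookup (P x) (\<phi> y)) = 0"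
    using arg_cong[OF assms(4), of "\<lambda>p. Poly_Mapping.lookup p (\<phi> y)"]
    by (simp add: lookup_sum lookup_Cst_mult)
  ultimately show False
    using y(1) has_initial_lookup(1)[OF assms(3)[of y]] by (auto simp: Y_def)
qed

lemma wgt_bound:
  assumes "finite V" "Poly_Mapping.keys m \<subseteq> V"
  shows "wgt w m \<le> (\<Sum>x\<in>V. w x) * wgt (\<lambda>_. 1) m"
proof -
  have "wgt w m \<le> (\<Sum>x\<in>Poly_Mapping.keys m. (\<Sum>x\<in>V. w x) * Poly_Mapping.lookup m x)"
    unfolding wgt_def using assms by (intro sum_mono mult_right_mono member_le_sum) auto
  then show ?thesis
    by (simp add: wgt_def sum_distrib_left)
qed

text \<open>Each monomial in \<open>V\<close> is initial in some \<open>P x\<close>. Subtracting it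
  from \<open>P x\<close> leaves monomials in \<open>V\<close> of the same degree and larger weight,
  which are dealt with by induction.\<close>

lemma initial_spanning:
  assumes "finite V"
    and "\<And>x. x \<in> I \<Longrightarrow> has_initial w (\<phi> x) (P x)"
    and "\<And>x. x \<in> I \<Longrightarrow> P x \<in> polys_in V"
    and "\<And>m. Poly_Mapping.keys m \<subseteq> V \<Longrightarrow> m \<in> \<phi> ` I"
    and "p \<in> polys_in V"
  shows "p \<in> comb P I"
proof -
  have reduce: "q \<in> comb P I"
    if "\<And>m. m \<in> Poly_Mapping.keys q \<Longrightarrow> Poly_Mapping.single m 1 \<in> comb P I" for q
  proof -
    have "(\<Sum>m\<in>Poly_Mapping.keys q. Cst (Poly_Mapping.lookup q m) * Poly_Mapping.single m 1) \<in> comb P I"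
      using that by (intro comb_sum comb_scale)
    also have "(\<Sum>m\<in>Poly_Mapping.keys q. Cst (Poly_Mapping.lookup q m) * Poly_Mapping.single m 1) = q"
      using sum_monomials[of q] by (simp add: Cst_def mult_single)
    finally show ?thesis .
  qed
  have "Poly_Mapping.single m 1 \<in> comb P I" if "Poly_Mapping.keys m \<subseteq> V" for m
    using that
  \<comment> \<open>The bound of \<open>wgt_bound\<close> depends only on the degree. Both weights
    stay below it, so the truncated difference strictly drops when the weight rises.\<close>
  proof (induction "(\<Sum>x\<in>V. w x) * wgt (\<lambda>_. 1) m - wgt w m" arbitrary: m rule: less_induct)
    case less
    obtain x where x: "x \<in> I" "m = \<phi> x"
      using assms(4)[OF less.prems] by auto
    obtain c q where cq: "c \<noteq> 0" "P x = Poly_Mapping.single m c + q" "Poly_Mapping.keys q \<subseteq> higher w m"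
      using assms(2)[OF x(1)] x(2) by (auto simp: has_initial_def)
    have "q = P x - Poly_Mapping.single m c"
      using cq(2) by simp
    then have q: "q \<in> polys_in V"
      using assms(3)[OF x(1)] less.prems by (auto intro: polys_in_diff polys_in_single)
    have "q \<in> comb P I"
    proof (rule reduce)
      fix m'
      assume m': "m' \<in> Poly_Mapping.keys q"
      have "Poly_Mapping.keys m' \<subseteq> V"
        using q m' by (auto simp: polys_in_def)
      moreover have "m' \<in> higher w m"
        using cq(3) m' by auto
      ultimately show "Poly_Mapping.single m' 1 \<in> comb P I"
        using wgt_bound[OF assms(1), of m' w] by (intro less.hyps) (auto simp: higher_def)
    qed
    \<comment> \<open>The monomial is \<open>(P x - q) / c\<close>.\<close>
    then have "Cst (1 / c) * (P x + Cst (-1) * q) \<in> comb P I"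
      using x(1) by (intro comb_scale comb_add comb_base)
    also have "P x + Cst (-1) * q = Poly_Mapping.single m c"
      using cq(2) by (simp add: Cst_def single_uminus)
    finally show ?case
      using cq(1) by (simp add: Cst_def mult_single)
  qed
  then show ?thesis
    using assms(5) by (auto simp: polys_in_def intro: reduce)
qed


section \<open>Freeness over a subalgebra whose generators have disjoint initial monomials\<close>

text \<open>The initial monomial of \<open>f i\<close> is the squarefree product of the variables in
  \<open>T i\<close>. By disjointness each exponent of a power product of these monomials can be
  read off at any single variable of \<open>T i\<close>.\<close>

locale disjoint_initials =
  fixes V :: "wt set" and w :: "wt \<Rightarrow> nat" and I :: "nat set" and T :: "nat \<Rightarrow> wt set" and f :: "nat \<Rightarrow> spoly"
  assumes finite_V: "finite V" and finite_I: "finite I"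
    and T_nonempty: "\<And>i. i \<in> I \<Longrightarrow> T i \<noteq> {}"
    and T_subset: "\<And>i. i \<in> I \<Longrightarrow> T i \<subseteq> V"
    and T_disjoint: "\<And>i j. i \<in> I \<Longrightarrow> j \<in> I \<Longrightarrow> i \<noteq> j \<Longrightarrow> T i \<inter> T j = {}"
    and f_in: "\<And>i. i \<in> I \<Longrightarrow> f i \<in> polys_in V"
    and f_initial: "\<And>i. i \<in> I \<Longrightarrow> has_initial w (\<Sum>x\<in>T i. Poly_Mapping.single x 1) (f i)"
begin

definition tmon :: "nat \<Rightarrow> (wt \<Rightarrow>\<^sub>0 nat)" where
  "tmon i = (\<Sum>x\<in>T i. Poly_Mapping.single x 1)"

text \<open>Fixing the values outside \<open>I\<close> makes the exponents of a power product
  unique.\<close>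

definition exps :: "(nat \<Rightarrow> nat) set" where
  "exps = {e. \<forall>i. i \<notin> I \<longrightarrow> e i = 0}"

definition fpow :: "(nat \<Rightarrow> nat) \<Rightarrow> spoly" where
  "fpow e = (\<Prod>i\<in>I. f i ^ e i)"

definition tpow :: "(nat \<Rightarrow> nat) \<Rightarrow> (wt \<Rightarrow>\<^sub>0 nat)" where
  "tpow e = (\<Sum>i\<in>I. \<Sum>j<e i. tmon i)"

text \<open>An exponent 0 somewhere on \<open>T i\<close> means that \<open>tmon i\<close> does not
  divide \<open>b\<close>.\<close>

definition standard :: "(wt \<Rightarrow>\<^sub>0 nat) set" where
  "standard = {b. Poly_Mapping.keys b \<subseteq> V \<and> (\<forall>i\<in>I. \<exists>x\<in>T i. Poly_Mapping.lookup b x = 0)}"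

abbreviation umon :: "(wt \<Rightarrow>\<^sub>0 nat) \<Rightarrow> spoly" where
  "umon b \<equiv> Poly_Mapping.single b 1"

lemma finite_T: "i \<in> I \<Longrightarrow> finite (T i)"
  using T_subset finite_V finite_subset by blast

lemma lookup_tmon:
  assumes "i \<in> I"
  shows "Poly_Mapping.lookup (tmon i) x = (if x \<in> T i then 1 else 0)"
  using finite_T[OF assms] by (simp add: tmon_def lookup_sum lookup_single when_def)

lemma lookup_tpow:
  assumes "i \<in> I" "x \<in> T i"
  shows "Poly_Mapping.lookup (tpow e) x = e i"
proof -
  have "x \<in> T j \<longleftrightarrow> j = i" if "j \<in> I" for j
    using T_disjoint[OF that assms(1)] assms(2) by blast
  then have "Poly_Mapping.lookup (tpow e) x = (\<Sum>j\<in>I. if j = i then e j else 0)"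
    unfolding tpow_def lookup_sum by (intro sum.cong refl) (simp add: lookup_tmon)
  then show ?thesis
    using finite_I assms(1) by simp
qed

lemma lookup_tpow_outside:
  assumes "x \<notin> (\<Union>i\<in>I. T i)"
  shows "Poly_Mapping.lookup (tpow e) x = 0"
  unfolding tpow_def lookup_sum
proof (intro sum.neutral ballI)
  fix i
  assume "i \<in> I"
  then show "Poly_Mapping.lookup (tmon i) x = 0"
    using assms by (simp add: lookup_tmon)
qed

lemma fpow_initial: "has_initial w (tpow e) (fpow e)"
  unfolding tpow_def fpow_def tmon_def
  by (intro has_initial_prod has_initial_power f_initial)

lemma fpow_add: "fpow (\<lambda>i. e i + e' i) = fpow e * fpow e'"
  by (simp add: fpow_def power_add prod.distrib)

lemma fpow_in: "fpow e \<in> polys_in V"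
  unfolding fpow_def by (intro polys_in_prod polys_in_power f_in)

text \<open>On \<open>T i\<close> both \<open>b\<close> and \<open>b'\<close> vanish somewhere.
  Comparing exponents at these two variables gives the two inequalities between \<open>e i\<close>
  and \<open>e' i\<close>.\<close>

lemma inj_standard: "inj_on (\<lambda>(b, e). b + tpow e) (standard \<times> exps)"
proof (rule inj_onI, clarify)
  fix b e b' e'
  assume b: "b \<in> standard" "b' \<in> standard" and e: "e \<in> exps" "e' \<in> exps" and eq: "b + tpow e = b' + tpow e'"
  have lk: "Poly_Mapping.lookup b x + e i = Poly_Mapping.lookup b' x + e' i" if "i \<in> I" "x \<in> T i" for i x
    using arg_cong[OF eq, of "\<lambda>m. Poly_Mapping.lookup m x"] that by (simp add: lookup_add lookup_tpow)
  have "e i = e' i" for i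
  proof (cases "i \<in> I")
    case True
    obtain x y where "x \<in> T i" "Poly_Mapping.lookup b x = 0" "y \<in> T i" "Poly_Mapping.lookup b' y = 0"
      using b True unfolding standard_def by blast
    then show ?thesis
      using lk[OF True, of x] lk[OF True, of y] by simp
  qed (use e in \<open>auto simp: exps_def\<close>)
  then have "e = e'" by blast
  then show "b = b' \<and> e = e'"
    using eq by simp
qed

lemma standard_surj:
  assumes "Poly_Mapping.keys m \<subseteq> V"
  shows "m \<in> (\<lambda>(b, e). b + tpow e) ` (standard \<times> exps)"
proof -
  \<comment> \<open>The minimum over \<open>T i\<close> is the largest power of
    \<open>tmon i\<close> that divides \<open>m\<close>.\<close>
  define e where "e i = (if i \<in> I then Min (Poly_Mapping.lookup m ` T i) else 0)" for i
  define b where "b = m - tpow e"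
  have le: "e i \<le> Poly_Mapping.lookup m x" if "i \<in> I" "x \<in> T i" for i x
    using that finite_T[OF that(1)] by (auto simp: e_def)
  have "m = b + tpow e"
  proof (rule poly_mapping_eqI)
    fix x
    have "Poly_Mapping.lookup (tpow e) x \<le> Poly_Mapping.lookup m x"
      using le lookup_tpow lookup_tpow_outside[of x e] by (cases "x \<in> (\<Union>i\<in>I. T i)") auto
    then show "Poly_Mapping.lookup m x = Poly_Mapping.lookup (b + tpow e) x"
      by (simp add: b_def lookup_add lookup_minus)
  qed
  moreover have "e \<in> exps"
    by (simp add: e_def exps_def)
  moreover have "b \<in> standard"
    unfolding standard_def
  proof (intro CollectI conjI ballI)
    show "Poly_Mapping.keys b \<subseteq> V"
      using assms by (auto simp: b_def in_keys_iff lookup_minus)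
    fix i assume i: "i \<in> I"
    have "e i \<in> Poly_Mapping.lookup m ` T i"
      using finite_T[OF i] T_nonempty[OF i] i by (simp add: e_def)
    then obtain x where "x \<in> T i" "e i = Poly_Mapping.lookup m x"
      by auto
    then show "\<exists>x\<in>T i. Poly_Mapping.lookup b x = 0"
      using i by (intro bexI[of _ x]) (auto simp: b_def lookup_minus lookup_tpow)
  qed
  ultimately show ?thesis
    by force
qed

section \<open>Products of standard monomials and powers of the generators form a complex
  basis\<close>

definition bprod :: "(wt \<Rightarrow>\<^sub>0 nat) \<times> (nat \<Rightarrow> nat) \<Rightarrow> spoly" where
  "bprod x = umon (fst x) * fpow (snd x)"

lemma bprod_initial: "has_initial w ((\<lambda>(b, e). b + tpow e) x) (bprod x)"
  by (auto simp: bprod_def case_prod_unfold intro!: has_initial_mult has_initial_single fpow_initial)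

lemma bprod_independent:
  assumes "finite Y" "Y \<subseteq> standard \<times> exps" "(\<Sum>x\<in>Y. Cst (c x) * bprod x) = 0" "x \<in> Y"
  shows "c x = 0"
  using initial_independent[OF assms(1) inj_on_subset[OF inj_standard assms(2)] bprod_initial assms(3)] assms(4)
  by blast

lemma bprod_spanning:
  assumes "p \<in> polys_in V"
  shows "p \<in> comb bprod (standard \<times> exps)"
  by (rule initial_spanning[OF finite_V bprod_initial _ standard_surj assms])
    (auto simp: bprod_def standard_def intro!: polys_in_mult polys_in_single fpow_in)

section \<open>The subalgebra generated by the \<open>f i\<close>, and freeness over it\<close>

definition G :: "spoly set" where
  "G = comb fpow exps"

lemma fpow_in_G: "(\<And>i. i \<notin> I \<Longrightarrow> e i = 0) \<Longrightarrow> fpow e \<in> G"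
  unfolding G_def by (rule comb_base) (simp add: exps_def)

lemma f_in_G:
  assumes "i \<in> I"
  shows "f i \<in> G"
proof -
  have "fpow (\<lambda>j. if j = i then 1 else 0) = (\<Prod>j\<in>I. if j = i then f j else 1)"
    unfolding fpow_def by (intro prod.cong) auto
  also have "\<dots> = f i"
    using assms finite_I by simp
  finally show ?thesis
    using fpow_in_G[of "\<lambda>j. if j = i then 1 else 0"] assms by force
qed

lemma G_0: "0 \<in> G"
  by (simp add: G_def comb_0)

lemma G_1: "1 \<in> G"
  using fpow_in_G[of "\<lambda>_. 0"] by (simp add: fpow_def)

lemma G_add: "p \<in> G \<Longrightarrow> q \<in> G \<Longrightarrow> p + q \<in> G"
  by (simp add: G_def comb_add)

lemma G_sum: "(\<And>x. x \<in> Y \<Longrightarrow> g x \<in> G) \<Longrightarrow> (\<Sum>x\<in>Y. g x) \<in> G"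
  by (simp add: G_def comb_sum)

lemma G_scale: "p \<in> G \<Longrightarrow> Cst a * p \<in> G"
  by (simp add: G_def comb_scale)

lemma G_Cst: "Cst a \<in> G"
  using G_scale[OF G_1] by simp

lemma G_mult:
  assumes "p \<in> G" "q \<in> G"
  shows "p * q \<in> G"
proof -
  obtain Y c where Y: "Y \<subseteq> exps" "p = (\<Sum>e\<in>Y. Cst (c e) * fpow e)"
    using assms(1) by (auto simp: G_def comb_def)
  obtain Z d where Z: "Z \<subseteq> exps" "q = (\<Sum>e\<in>Z. Cst (d e) * fpow e)"
    using assms(2) by (auto simp: G_def comb_def)
  have "p * q = (\<Sum>e\<in>Y. \<Sum>e'\<in>Z. Cst (c e * d e') * fpow (\<lambda>i. e i + e' i))"
    unfolding Y(2) Z(2) sum_product fpow_add by (simp add: algebra_simps)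
  also have "\<dots> \<in> G"
    using Y(1) Z(1) by (intro G_sum G_scale fpow_in_G) (auto simp: exps_def)
  finally show ?thesis .
qed

lemma G_power: "p \<in> G \<Longrightarrow> p ^ k \<in> G"
  by (induction k) (auto intro: G_1 G_mult)

lemma G_prod: "(\<And>x. x \<in> Y \<Longrightarrow> g x \<in> G) \<Longrightarrow> (\<Prod>x\<in>Y. g x) \<in> G"
  by (induction Y rule: infinite_finite_induct) (auto intro: G_1 G_mult)

lemma G_diff: "p \<in> G \<Longrightarrow> q \<in> G \<Longrightarrow> p - q \<in> G"
  using G_add[of p "Cst (-1) * q"] G_scale[of q "-1"] by (simp add: Cst_def single_uminus)

lemma G_subset: "G \<subseteq> polys_in V"
  by (auto simp: G_def comb_def intro!: polys_in_sum polys_in_mult fpow_in)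

text \<open>Collect the terms of a complex combination of the \<open>bprod\<close> that share the
  same standard monomial.\<close>

lemma spanning_G:
  assumes "p \<in> polys_in V"
  shows "\<exists>F g. finite F \<and> F \<subseteq> standard \<and> (\<forall>b\<in>F. g b \<in> G) \<and> p = (\<Sum>b\<in>F. g b * umon b)"
proof -
  obtain Y c where Y: "finite Y" "Y \<subseteq> standard \<times> exps" "p = (\<Sum>x\<in>Y. Cst (c x) * bprod x)"
    using bprod_spanning[OF assms] by (auto simp: comb_def)
  define g where "g b = (\<Sum>x\<in>{x \<in> Y. fst x = b}. Cst (c x) * fpow (snd x))" for b
  have "p = (\<Sum>b\<in>fst ` Y. \<Sum>x\<in>{x \<in> Y. fst x = b}. Cst (c x) * bprod x)"
    unfolding Y(3) using Y(1) by (rule sum.image_gen)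
  also have "\<dots> = (\<Sum>b\<in>fst ` Y. g b * umon b)"
    unfolding g_def sum_distrib_right
    by (intro sum.cong refl) (auto simp: bprod_def algebra_simps)
  finally show ?thesis
    using Y(1,2) by (intro exI[of _ "fst ` Y"] exI[of _ g]) (auto simp: g_def exps_def intro!: G_sum G_scale fpow_in_G)
qed

text \<open>Expanding every coefficient into power products turns a relation over \<open>G\<close>
  into a complex relation among the \<open>bprod\<close>.\<close>

lemma independent_G:
  assumes "finite F" "F \<subseteq> standard" "\<And>b. b \<in> F \<Longrightarrow> g b \<in> G" "(\<Sum>b\<in>F. g b * umon b) = 0" "b \<in> F"
  shows "g b = 0"
proof -
  have "\<forall>b\<in>F. \<exists>Y c. finite Y \<and> Y \<subseteq> exps \<and> g b = (\<Sum>e\<in>Y. Cst (c e) * fpow e)"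
    using assms(3) by (fastforce simp: G_def comb_def)
  from bchoice[OF this] obtain Y
    where "\<forall>b\<in>F. \<exists>c. finite (Y b) \<and> Y b \<subseteq> exps \<and> g b = (\<Sum>e\<in>Y b. Cst (c e) * fpow e)" ..
  from bchoice[OF this] obtain c
    where "\<forall>b\<in>F. finite (Y b) \<and> Y b \<subseteq> exps \<and> g b = (\<Sum>e\<in>Y b. Cst (c b e) * fpow e)" ..
  then have Y: "\<And>b. b \<in> F \<Longrightarrow> finite (Y b)" "\<And>b. b \<in> F \<Longrightarrow> Y b \<subseteq> exps"
      "\<And>b. b \<in> F \<Longrightarrow> g b = (\<Sum>e\<in>Y b. Cst (c b e) * fpow e)"
    by blast+
  have "(\<Sum>b\<in>F. g b * umon b) = (\<Sum>b\<in>F. \<Sum>e\<in>Y b. Cst (c b e) * bprod (b, e))"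
    by (intro sum.cong refl) (simp add: Y(3) sum_distrib_left bprod_def algebra_simps)
  also have "\<dots> = (\<Sum>x\<in>Sigma F Y. Cst (case_prod c x) * bprod x)"
    using assms(1) Y(1) by (subst sum.Sigma) (auto simp: case_prod_unfold)
  finally have "(\<Sum>x\<in>Sigma F Y. Cst (case_prod c x) * bprod x) = 0"
    using assms(4) by simp
  moreover have "finite (Sigma F Y)" "Sigma F Y \<subseteq> standard \<times> exps"
    using assms(1,2) Y(1,2) by auto
  ultimately have "c b e = 0" if "e \<in> Y b" for e
    using bprod_independent[of "Sigma F Y" "case_prod c" "(b, e)"] assms(5) that by simp
  then show ?thesis
    using Y(3)[OF assms(5)] by simp
qed

lemma inj_umon: "inj umon"
  by (rule injI) (metis keys_single one_neq_zero singleton_inject)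

theorem free_over_G: "free_over G (polys_in V)"
  unfolding free_over_def
proof (intro exI conjI)
  show "umon ` standard \<subseteq> polys_in V"
    by (auto simp: standard_def intro!: polys_in_single)
  have "\<exists>F c. p = (\<Sum>b\<in>F. c b * b) \<and> finite F \<and> F \<subseteq> umon ` standard \<and> (\<forall>b\<in>F. c b \<in> G)"
    if p: "p \<in> polys_in V" for p
  proof -
    obtain F g where F: "finite F" "F \<subseteq> standard" "\<And>b. b \<in> F \<Longrightarrow> g b \<in> G" "p = (\<Sum>b\<in>F. g b * umon b)"
      using spanning_G[OF p] by blast
    \<comment> \<open>The basis is a set of polynomials, so the coefficients indexed by monomials
      are carried over along the injection \<open>umon\<close>.\<close>
    have "p = (\<Sum>b\<in>umon ` F. g (inv_into UNIV umon b) * b)"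
      unfolding F(4) by (subst sum.reindex[OF inj_on_subset[OF inj_umon]]) (auto simp: inv_f_f[OF inj_umon])
    then show ?thesis
      using F(1-3) by (intro exI[of _ "umon ` F"] exI[of _ "\<lambda>b. g (inv_into UNIV umon b)"]) (auto simp: inv_f_f[OF inj_umon])
  qed
  moreover have "(\<Sum>b\<in>F. c b * b) \<in> polys_in V" if "F \<subseteq> umon ` standard" "\<forall>b\<in>F. c b \<in> G" for F c
    using that G_subset by (intro polys_in_sum polys_in_mult) (auto simp: standard_def intro!: polys_in_single)
  ultimately show "polys_in V = {\<Sum>b\<in>F. c b * b |F c. finite F \<and> F \<subseteq> umon ` standard \<and> (\<forall>b\<in>F. c b \<in> G)}"
    by auto
  show "\<forall>F c. finite F \<and> F \<subseteq> umon ` standard \<and> (\<forall>b\<in>F. c b \<in> G) \<and> (\<Sum>b\<in>F. c b * b) = 0 \<longrightarrow> (\<forall>b\<in>F. c b = 0)"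
  proof (intro allI impI, elim conjE)
    fix F and c :: "spoly \<Rightarrow> spoly"
    assume F: "finite F" "F \<subseteq> umon ` standard" "\<forall>b\<in>F. c b \<in> G" "(\<Sum>b\<in>F. c b * b) = 0"
    obtain F' where F': "F' \<subseteq> standard" "F = umon ` F'"
      using F(2) by (auto simp: subset_image_iff)
    have inj: "inj_on umon F'"
      by (rule inj_on_subset[OF inj_umon]) simp
    have "finite F'"
      using F(1) inj by (simp add: F'(2) finite_image_iff)
    moreover have "(\<Sum>b\<in>F'. c (umon b) * umon b) = 0"
      using F(4) unfolding F'(2) sum.reindex[OF inj] by simp
    ultimately have "c (umon b) = 0" if "b \<in> F'" for b
      using independent_G[of F' "\<lambda>b. c (umon b)" b] F'(1) F(3) that by (auto simp: F'(2))
    then show "\<forall>b\<in>F. c b = 0"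
      by (simp add: F'(2))
  qed
qed

text \<open>The exponent 0 stands for the monomial 1, so 1 belongs to the basis over
  \<open>G\<close>.\<close>

lemma zero_standard: "0 \<in> standard"
  using T_nonempty by (auto simp: standard_def)

text \<open>The element \<open>r * p\<close> has two expansions in the basis: \<open>r * p\<close>
  times the basis element 1, and the expansion of \<open>p\<close> multiplied by \<open>r\<close>.
  Comparison gives \<open>r * g b = 0\<close> for \<open>b\<close> different from 0, so
  \<open>p\<close> is its own coefficient at 1.\<close>

theorem G_saturated:
  assumes "p \<in> polys_in V" "r \<in> G" "r \<noteq> 0" "r * p \<in> G"
  shows "p \<in> G"
proof -
  obtain F g where F: "finite F" "F \<subseteq> standard" "\<And>b. b \<in> F \<Longrightarrow> g b \<in> G" "p = (\<Sum>b\<in>F. g b * umon b)"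
    using spanning_G[OF assms(1)] by blast
  \<comment> \<open>The difference of the two expansions of \<open>r * p\<close>, over the index set
    \<open>insert 0 F\<close>.\<close>
  define h where "h b = (if b \<in> F then r * g b else 0) - (if b = 0 then r * p else 0)" for b
  have "(\<Sum>b\<in>insert 0 F. (if b \<in> F then r * g b else 0) * umon b) = (\<Sum>b\<in>F. r * g b * umon b)"
    using F(1) by (intro sum.mono_neutral_cong_right) auto
  moreover have "(\<Sum>b\<in>insert 0 F. (if b = 0 then r * p else 0) * umon b) = (\<Sum>b\<in>{0}. r * p * umon b)"
    using F(1) by (intro sum.mono_neutral_cong_right) auto
  ultimately have "(\<Sum>b\<in>insert 0 F. h b * umon b) = r * (\<Sum>b\<in>F. g b * umon b) - r * p"
    by (simp add: h_def left_diff_distrib sum_subtractf sum_distrib_left mult.assoc)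
  then have "(\<Sum>b\<in>insert 0 F. h b * umon b) = 0"
    by (simp add: F(4))
  moreover have "h b \<in> G" if "b \<in> insert 0 F" for b
    unfolding h_def using F(3) assms(2,4) G_0 by (intro G_diff) (auto intro!: G_mult)
  ultimately have "h b = 0" if "b \<in> F" for b
    using independent_G[of "insert 0 F" h b] F(1,2) zero_standard that by auto
  then have "g b = 0" if "b \<in> F" "b \<noteq> 0" for b
    using assms(3) that by (fastforce simp: h_def)
  then have "p = (\<Sum>b\<in>F. if b = 0 then g b else 0)"
    unfolding F(4) by (intro sum.cong) auto
  then show ?thesis
    using F(3) G_0 by (auto intro!: G_sum)
qed

end


section \<open>Roots and nilradicals\<close>

text \<open>Indices start at 0 as for matrix entries: for distinct \<open>a\<close> and
  \<open>b\<close>, \<open>rt a b\<close> is the root of the matrix unit at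
  \<open>(a, b)\<close>.\<close>

definition rt :: "nat \<Rightarrow> nat \<Rightarrow> wt" where
  "rt a b = eps (a + 1) - eps (b + 1)"

lemma lookup_rt: "Poly_Mapping.lookup (rt a b) k = (if k = a + 1 then 1 else 0) - (if k = b + 1 then 1 else 0)"
  by (auto simp: rt_def eps_def lookup_minus lookup_single when_def)

lemma rt_inj:
  assumes "a \<noteq> b"
  shows "rt a b = rt c d \<longleftrightarrow> a = c \<and> b = d"
proof
  assume eq: "rt a b = rt c d"
  show "a = c \<and> b = d"
    using arg_cong[OF eq, of "\<lambda>x. Poly_Mapping.lookup x (a + 1)"]
      arg_cong[OF eq, of "\<lambda>x. Poly_Mapping.lookup x (b + 1)"] assms
    by (auto simp: lookup_rt split: if_splits)
qed simp

lemma simple_root_eq_rt: "1 \<le> k \<Longrightarrow> simple_root k = rt (k - 1) k"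
  by (simp add: simple_root_def rt_def)

lemma inj_on_simple_root: "inj_on simple_root {1..n}"
proof (rule inj_onI)
  fix j k
  assume "j \<in> {1..n}" "k \<in> {1..n}" "simple_root j = simple_root k"
  moreover from this have "j - 1 \<noteq> j"
    by auto
  ultimately show "j = k"
    using rt_inj[of "j - 1" j "k - 1" k] by (simp add: simple_root_eq_rt)
qed

lemma pos_roots_eq: "pos_roots n = {rt a b | a b. a < b \<and> b \<le> n}" (is "_ = ?R")
proof
  show "pos_roots n \<subseteq> ?R"
  proof
    fix \<gamma> assume "\<gamma> \<in> pos_roots n"
    then obtain i j where "\<gamma> = eps i - eps j" "1 \<le> i" "i < j" "j \<le> n + 1"
      by (auto simp: pos_roots_def)
    then have "\<gamma> = rt (i - 1) (j - 1) \<and> i - 1 < j - 1 \<and> j - 1 \<le> n"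
      by (auto simp: rt_def)
    then show "\<gamma> \<in> ?R"
      by blast
  qed
  show "?R \<subseteq> pos_roots n"
  proof
    fix \<gamma> assume "\<gamma> \<in> ?R"
    then obtain a b where "\<gamma> = eps (a + 1) - eps (b + 1)" "a < b" "b \<le> n"
      by (auto simp: rt_def)
    then show "\<gamma> \<in> pos_roots n"
      unfolding pos_roots_def by (intro CollectI exI[of _ "a + 1"] exI[of _ "b + 1"]) auto
  qed
qed

text \<open>The shift of indices makes the interval half-open: \<open>rt a b\<close> is the sum of
  \<open>\<alpha>\<^sub>k\<close> over \<open>a < k \<le> b\<close>. This is the condition for
  \<open>\<alpha>\<^sub>k\<close> to occur in a root throughout.\<close>

lemma sum_simple_roots: "a \<le> b \<Longrightarrow> (\<Sum>k\<in>{a<..b}. simple_root k) = rt a b"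
proof (induction b rule: dec_induct)
  case base
  then show ?case by (simp add: rt_def)
next
  case (step b)
  have "{a<..Suc b} = insert (Suc b) {a<..b}"
    using step by auto
  then show ?case
    using step by (simp add: rt_def simple_root_def)
qed

text \<open>As \<open>root_coeff\<close> is a definite description, both a witness, the indicator
  \<open>c0\<close>, and uniqueness are needed.\<close>

lemma root_coeff_rt:
  assumes "a < b" "b \<le> n" "k \<in> {1..n}"
  shows "root_coeff n (rt a b) (simple_root k) = (if a < k \<and> k \<le> b then 1 else 0)"
proof -
  define good where "good c \<longleftrightarrow> (\<forall>\<beta>. \<beta> \<notin> simple_roots n \<longrightarrow> c \<beta> = 0) \<and>
      rt a b = (\<Sum>\<beta>\<in>simple_roots n. frag_cmul (c \<beta>) \<beta>)" for c :: "wt \<Rightarrow> int"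
  define c0 :: "wt \<Rightarrow> int" where "c0 \<beta> = (if \<beta> \<in> simple_root ` {a<..b} then 1 else 0)" for \<beta>
  have reindex: "(\<Sum>\<beta>\<in>simple_roots n. frag_cmul (c \<beta>) \<beta>) =
      (\<Sum>k\<in>{1..n}. frag_cmul (c (simple_root k)) (simple_root k))" for c
    unfolding simple_roots_def sum.reindex[OF inj_on_simple_root] comp_def ..
  have c0: "c0 (simple_root k) = (if k \<in> {a<..b} then 1 else 0)" if "k \<in> {1..n}" for k
  proof -
    have "simple_root k \<in> simple_root ` {a<..b} \<longleftrightarrow> k \<in> {a<..b}"
      using that assms by (intro inj_on_image_mem_iff[OF inj_on_simple_root[of n]]) auto
    then show ?thesis
      by (simp add: c0_def)
  qed
  have "good c0"
    unfolding good_def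
  proof
    show "\<forall>\<beta>. \<beta> \<notin> simple_roots n \<longrightarrow> c0 \<beta> = 0"
      using assms by (auto simp: c0_def simple_roots_def)
    have "(\<Sum>k\<in>{1..n}. frag_cmul (c0 (simple_root k)) (simple_root k)) =
        (\<Sum>k\<in>{1..n}. if k \<in> {a<..b} then simple_root k else 0)"
      using c0 by (intro sum.cong) auto
    also have "\<dots> = (\<Sum>k\<in>{a<..b}. simple_root k)"
      using assms by (intro sum.mono_neutral_cong_right) auto
    finally show "rt a b = (\<Sum>\<beta>\<in>simple_roots n. frag_cmul (c0 \<beta>) \<beta>)"
      using assms by (simp add: reindex sum_simple_roots)
  qed
  \<comment> \<open>The sum of the first \<open>k\<close> coordinates is 1 on
    \<open>\<alpha>\<^sub>k\<close> and 0 on all other simple roots, so it recovers the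
    coefficient.\<close>
  have coeff: "c (simple_root k) = (\<Sum>j\<in>{1..k}. Poly_Mapping.lookup (rt a b) j)"
    if "good c" "k \<in> {1..n}" for c k
  proof -
    have "(\<Sum>j\<in>{1..k}. Poly_Mapping.lookup (rt a b) j) =
        (\<Sum>j\<in>{1..k}. \<Sum>i\<in>{1..n}. c (simple_root i) * Poly_Mapping.lookup (simple_root i) j)"
      using that(1) by (simp add: good_def reindex lookup_sum)
    also have "\<dots> = (\<Sum>i\<in>{1..n}. c (simple_root i) * (\<Sum>j\<in>{1..k}. Poly_Mapping.lookup (simple_root i) j))"
      by (subst sum.swap) (simp add: sum_distrib_left)
    also have "\<dots> = (\<Sum>i\<in>{1..n}. if i = k then c (simple_root i) else 0)"
    proof (rule sum.cong[OF refl])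
      fix i assume i: "i \<in> {1..n}"
      have "(\<Sum>j\<in>{1..k}. Poly_Mapping.lookup (simple_root i) j) =
          (\<Sum>j\<in>{1..k}. if j = i then 1 else 0) - (\<Sum>j\<in>{1..k}. if j = i + 1 then 1 else 0)"
        using i unfolding sum_subtractf[symmetric]
        by (intro sum.cong) (auto simp: simple_root_eq_rt lookup_rt)
      also have "\<dots> = (if i = k then 1 else 0)"
        using i by (simp add: sum.delta)
      finally show "c (simple_root i) * (\<Sum>j\<in>{1..k}. Poly_Mapping.lookup (simple_root i) j) =
          (if i = k then c (simple_root i) else 0)"
        by simp
    qed
    also have "\<dots> = c (simple_root k)"
      using that(2) by simp
    finally show ?thesis by simp
  qed
  have unique: "c = c'" if "good c" "good c'" for c c'
  proof (rule ext)
    fix \<beta>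
    show "c \<beta> = c' \<beta>"
    proof (cases "\<beta> \<in> simple_roots n")
      case True
      then show ?thesis
        using coeff[OF that(1)] coeff[OF that(2)] by (auto simp: simple_roots_def)
    qed (use that in \<open>simp add: good_def\<close>)
  qed
  have "(THE c. good c) = c0"
    using \<open>good c0\<close> by (intro the_equality unique)
  then show ?thesis
    using c0[OF assms(3)] by (simp add: root_coeff_def good_def)
qed

definition nil_roots :: "nat \<Rightarrow> nat set \<Rightarrow> wt set" where
  "nil_roots n K = {rt a b | a b. a < b \<and> b \<le> n \<and> (\<exists>k\<in>K. a < k \<and> k \<le> b)}"

lemma nil_roots_eq:
  assumes "K \<subseteq> {1..n}"
  shows "{\<gamma> \<in> pos_roots n. \<exists>\<alpha>\<in>simple_root ` K. root_coeff n \<gamma> \<alpha> > 0} = nil_roots n K"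
proof -
  have "(\<exists>\<alpha>\<in>simple_root ` K. root_coeff n (rt a b) \<alpha> > 0) \<longleftrightarrow> (\<exists>k\<in>K. a < k \<and> k \<le> b)"
    if "a < b" "b \<le> n" for a b
    using that assms by (auto simp: root_coeff_rt subset_iff split: if_splits)
  then show ?thesis
    unfolding pos_roots_eq nil_roots_def by blast
qed

lemma rt_in_nil_roots:
  "a < b \<Longrightarrow> rt a b \<in> nil_roots n K \<longleftrightarrow> b \<le> n \<and> (\<exists>k\<in>K. a < k \<and> k \<le> b)"
  by (auto simp: nil_roots_def rt_inj)

section \<open>Root spaces and nilradicals as sets of matrices with given support\<close>

lemma index_mult_diag_left:
  assumes "diagonal_mat H" "H \<in> carrier_mat N N" "X \<in> carrier_mat N N" "i < N" "j < N"
  shows "(H * X) $$ (i, j) = H $$ (i, i) * X $$ (i, j)"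
proof -
  have "(H * X) $$ (i, j) = (\<Sum>k\<in>{0..<N}. H $$ (i, k) * X $$ (k, j))"
    using assms by (simp add: scalar_prod_def)
  also have "\<dots> = (\<Sum>k\<in>{0..<N}. if k = i then H $$ (i, k) * X $$ (k, j) else 0)"
    using assms by (intro sum.cong) (auto simp: diagonal_mat_def)
  finally show ?thesis
    using assms(4) by simp
qed

lemma index_mult_diag_right:
  assumes "diagonal_mat H" "H \<in> carrier_mat N N" "X \<in> carrier_mat N N" "i < N" "j < N"
  shows "(X * H) $$ (i, j) = X $$ (i, j) * H $$ (j, j)"
proof -
  have "(X * H) $$ (i, j) = (\<Sum>k\<in>{0..<N}. X $$ (i, k) * H $$ (k, j))"
    using assms by (simp add: scalar_prod_def)
  also have "\<dots> = (\<Sum>k\<in>{0..<N}. if k = j then X $$ (i, k) * H $$ (k, j) else 0)"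
    using assms by (intro sum.cong) (auto simp: diagonal_mat_def)
  finally show ?thesis
    using assms(5) by simp
qed

lemma wt_eval_rt:
  assumes "a \<le> n" "b \<le> n"
  shows "wt_eval n (rt a b) H = H $$ (a, a) - H $$ (b, b)"
proof -
  have "wt_eval n (rt a b) H = (\<Sum>i\<in>{1..n + 1}. (if i = a + 1 then H $$ (i - 1, i - 1) else 0)
      - (if i = b + 1 then H $$ (i - 1, i - 1) else 0))"
    unfolding wt_eval_def by (intro sum.cong) (auto simp: lookup_rt)
  then show ?thesis
    using assms by (simp add: sum_subtractf)
qed

text \<open>The bracket with a diagonal \<open>H\<close> scales entry \<open>(i, j)\<close> by the
  difference of the diagonal entries \<open>i\<close> and \<open>j\<close>. Distinct positions off
  the diagonal have distinct weights, and diagonal positions have weight 0, so only one entry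
  survives.\<close>

lemma root_space_rt:
  assumes "a \<le> n" "b \<le> n" "a \<noteq> b"
  shows "root_space n (rt a b) =
    {X \<in> carrier_mat (n + 1) (n + 1). \<forall>i\<le>n. \<forall>j\<le>n. (i, j) \<noteq> (a, b) \<longrightarrow> X $$ (i, j) = 0}" (is "_ = ?R")
proof
  show "root_space n (rt a b) \<subseteq> ?R"
  proof
    fix X assume X: "X \<in> root_space n (rt a b)"
    then have carr: "X \<in> carrier_mat (n + 1) (n + 1)"
      by (simp add: root_space_def sl_def)
    have "X $$ (i, j) = 0" if ij: "i \<le> n" "j \<le> n" "(i, j) \<noteq> (a, b)" for i j
    proof -
      \<comment> \<open>The diagonal of \<open>H\<close> is the weight \<open>\<epsilon>\<^sub>i - \<epsilon>\<^sub>j - \<epsilon>\<^sub>a + \<epsilon>\<^sub>b\<close> itself, on which that weight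
        takes a positive value.\<close>
      define h :: "nat \<Rightarrow> complex" where "h k = (if k = i then 1 else 0) - (if k = j then 1 else 0)
        - (if k = a then 1 else 0) + (if k = b then 1 else 0)" for k
      define H where "H = mat (n + 1) (n + 1) (\<lambda>(k, l). if k = l then h k else 0)"
      have "(\<Sum>k<n + 1. H $$ (k, k)) = (\<Sum>k<n + 1. h k)"
        by (intro sum.cong) (auto simp: H_def)
      also have "\<dots> = 0"
        using assms ij by (simp only: h_def sum.distrib sum_subtractf sum.delta) auto
      finally have H: "H \<in> cartan n"
        by (auto simp: cartan_def sl_def H_def diagonal_mat_def)
      then have "H * X - X * H = wt_eval n (rt a b) H \<cdot>\<^sub>m X"
        using X by (simp add: root_space_def)
      then have "(H * X - X * H) $$ (i, j) = (wt_eval n (rt a b) H \<cdot>\<^sub>m X) $$ (i, j)"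
        by simp
      moreover have dH: "diagonal_mat H" "H \<in> carrier_mat (n + 1) (n + 1)"
        using H by (auto simp: cartan_def sl_def)
      ultimately have "h i * X $$ (i, j) - X $$ (i, j) * h j = (h a - h b) * X $$ (i, j)"
        using carr ij assms index_mult_diag_left[OF dH carr, of i j] index_mult_diag_right[OF dH carr, of i j]
        by (simp add: wt_eval_rt H_def)
      then have "(h i - h j - h a + h b) * X $$ (i, j) = 0"
        by (simp add: algebra_simps)
      moreover have "h i - h j - h a + h b \<noteq> 0"
        using ij(3) assms(3) by (auto simp: h_def)
      ultimately show ?thesis
        by simp
    qed
    then show "X \<in> ?R"
      using carr by blast
  qed
  show "?R \<subseteq> root_space n (rt a b)"
  proof
    fix X assume X: "X \<in> ?R"
    then have carr: "X \<in> carrier_mat (n + 1) (n + 1)"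
      and zero: "\<And>i j. i \<le> n \<Longrightarrow> j \<le> n \<Longrightarrow> (i, j) \<noteq> (a, b) \<Longrightarrow> X $$ (i, j) = 0"
      by auto
    have "X \<in> sl n"
      using carr zero assms(3) by (auto simp: sl_def intro!: sum.neutral)
    moreover have "H * X - X * H = wt_eval n (rt a b) H \<cdot>\<^sub>m X" if "H \<in> cartan n" for H
    proof (rule eq_matI)
      have dH: "diagonal_mat H" "H \<in> carrier_mat (n + 1) (n + 1)"
        using that by (auto simp: cartan_def sl_def)
      show "dim_row (H * X - X * H) = dim_row (wt_eval n (rt a b) H \<cdot>\<^sub>m X)"
        "dim_col (H * X - X * H) = dim_col (wt_eval n (rt a b) H \<cdot>\<^sub>m X)"
        using dH carr by auto
      fix i j
      assume "i < dim_row (wt_eval n (rt a b) H \<cdot>\<^sub>m X)" "j < dim_col (wt_eval n (rt a b) H \<cdot>\<^sub>m X)"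
      then have ij: "i < n + 1" "j < n + 1"
        using carr by auto
      have "(H * X - X * H) $$ (i, j) = (H $$ (i, i) - H $$ (j, j)) * X $$ (i, j)"
        using ij dH carr index_mult_diag_left[OF dH carr ij] index_mult_diag_right[OF dH carr ij]
        by (simp add: algebra_simps)
      also have "\<dots> = wt_eval n (rt a b) H * X $$ (i, j)"
        using zero[of i j] ij assms by (cases "(i, j) = (a, b)") (auto simp: wt_eval_rt)
      finally show "(H * X - X * H) $$ (i, j) = (wt_eval n (rt a b) H \<cdot>\<^sub>m X) $$ (i, j)"
        using ij carr by simp
    qed
    ultimately show "X \<in> root_space n (rt a b)"
      by (simp add: root_space_def)
  qed
qed

text \<open>For a set \<open>R\<close> of positive roots this is the sum of the root spaces;
  inclusions of nilradicals thus reduce to inclusions of root sets.\<close>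

definition mats_in :: "nat \<Rightarrow> wt set \<Rightarrow> complex mat set" where
  "mats_in n R = {X \<in> carrier_mat (n + 1) (n + 1).
     \<forall>i\<le>n. \<forall>j\<le>n. X $$ (i, j) \<noteq> 0 \<longrightarrow> i < j \<and> rt i j \<in> R}"

lemma finite_pos_roots: "finite (pos_roots n)"
proof -
  have "pos_roots n \<subseteq> (\<lambda>(a, b). rt a b) ` ({..n} \<times> {..n})"
    by (auto simp: pos_roots_eq)
  then show ?thesis
    by (rule finite_subset) auto
qed

lemma mat_sum_root_spaces:
  assumes "R \<subseteq> pos_roots n"
  shows "{mat_sum (n + 1) X R | X. \<forall>\<gamma>\<in>R. X \<gamma> \<in> root_space n \<gamma>} = mats_in n R" (is "?L = _")
proof
  have fin: "finite R"
    using assms finite_pos_roots finite_subset by blast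
  show "?L \<subseteq> mats_in n R"
  proof
    fix Y assume "Y \<in> ?L"
    then obtain X where X: "Y = mat_sum (n + 1) X R" "\<And>\<gamma>. \<gamma> \<in> R \<Longrightarrow> X \<gamma> \<in> root_space n \<gamma>"
      by auto
    have "i < j \<and> rt i j \<in> R" if "i \<le> n" "j \<le> n" "Y $$ (i, j) \<noteq> 0" for i j
    proof -
      have "(\<Sum>\<gamma>\<in>R. X \<gamma> $$ (i, j)) \<noteq> 0"
        using that by (simp add: X(1) mat_sum_def)
      then obtain \<gamma> where g: "\<gamma> \<in> R" "X \<gamma> $$ (i, j) \<noteq> 0"
        by (auto elim: sum.not_neutral_contains_not_neutral)
      obtain a b where ab: "\<gamma> = rt a b" "a < b" "b \<le> n"
        using g(1) assms by (auto simp: pos_roots_eq)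
      have "(i, j) = (a, b)"
        using X(2)[OF g(1)] g(2) ab that root_space_rt[of a n b] by auto
      then show ?thesis
        using g(1) ab by simp
    qed
    then show "Y \<in> mats_in n R"
      by (auto simp: mats_in_def X(1) mat_sum_def)
  qed
  show "mats_in n R \<subseteq> ?L"
  proof
    fix Y assume Y: "Y \<in> mats_in n R"
    define X where "X \<gamma> = mat (n + 1) (n + 1) (\<lambda>(i, j). if \<gamma> = rt i j then Y $$ (i, j) else 0)" for \<gamma>
    have "X \<gamma> \<in> root_space n \<gamma>" if \<gamma>: "\<gamma> \<in> R" for \<gamma>
    proof -
      obtain a b where ab: "\<gamma> = rt a b" "a < b" "b \<le> n"
        using \<gamma> assms by (auto simp: pos_roots_eq)
      then show ?thesis
        using root_space_rt[of a n b] by (auto simp: X_def rt_inj)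
    qed
    moreover have "Y = mat_sum (n + 1) X R"
    proof (rule eq_matI)
      show "dim_row Y = dim_row (mat_sum (n + 1) X R)" "dim_col Y = dim_col (mat_sum (n + 1) X R)"
        using Y by (auto simp: mats_in_def mat_sum_def)
      fix i j assume "i < dim_row (mat_sum (n + 1) X R)" "j < dim_col (mat_sum (n + 1) X R)"
      then have ij: "i \<le> n" "j \<le> n"
        by (auto simp: mat_sum_def)
      have "mat_sum (n + 1) X R $$ (i, j) = (\<Sum>\<gamma>\<in>R. if \<gamma> = rt i j then Y $$ (i, j) else 0)"
        using ij by (simp add: mat_sum_def X_def)
      also have "\<dots> = Y $$ (i, j)"
        using fin Y ij by (auto simp: mats_in_def)
      finally show "Y $$ (i, j) = mat_sum (n + 1) X R $$ (i, j)"
        by simp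
    qed
    ultimately show "Y \<in> ?L"
      by blast
  qed
qed

lemma nil_of_eq:
  assumes "K \<subseteq> {1..n}"
  shows "nil_of n (simple_root ` K) = mats_in n (nil_roots n K)"
proof -
  have "nil_roots n K \<subseteq> pos_roots n"
    by (auto simp: nil_roots_def pos_roots_eq)
  then show ?thesis
    unfolding nil_of_def nil_roots_eq[OF assms] Let_def by (rule mat_sum_root_spaces)
qed

text \<open>The matrix unit \<open>E\<close> in the root space tests whether the root belongs to
  \<open>R\<close>.\<close>

lemma roots_of_mats_in:
  assumes "R \<subseteq> pos_roots n"
  shows "roots_of n (mats_in n R) = R"
proof -
  have "root_space n \<gamma> \<subseteq> mats_in n R \<longleftrightarrow> \<gamma> \<in> R" if pos: "\<gamma> \<in> pos_roots n" for \<gamma>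
  proof -
    obtain a b where ab: "\<gamma> = rt a b" "a < b" "b \<le> n"
      using pos by (auto simp: pos_roots_eq)
    have sp: "root_space n \<gamma> =
        {X \<in> carrier_mat (n + 1) (n + 1). \<forall>i\<le>n. \<forall>j\<le>n. (i, j) \<noteq> (a, b) \<longrightarrow> X $$ (i, j) = 0}"
      using root_space_rt[of a n b] ab by simp
    define E :: "complex mat" where "E = mat (n + 1) (n + 1) (\<lambda>p. if p = (a, b) then 1 else 0)"
    have E: "E \<in> root_space n \<gamma>"
      unfolding sp by (auto simp: E_def)
    show ?thesis
    proof
      assume "root_space n \<gamma> \<subseteq> mats_in n R"
      then have "E \<in> mats_in n R"
        using E by blast
      moreover have "E $$ (a, b) = 1"
        using ab by (simp add: E_def)
      ultimately show "\<gamma> \<in> R"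
        using ab by (auto simp: mats_in_def)
    next
      assume "\<gamma> \<in> R"
      then show "root_space n \<gamma> \<subseteq> mats_in n R"
        unfolding sp using ab by (auto simp: mats_in_def)
    qed
  qed
  then show ?thesis
    using assms by (auto simp: roots_of_def)
qed

lemma roots_of_nil_of:
  assumes "K \<subseteq> {1..n}"
  shows "roots_of n (nil_of n (simple_root ` K)) = nil_roots n K"
  unfolding nil_of_eq[OF assms]
  by (rule roots_of_mats_in) (auto simp: nil_roots_def pos_roots_eq)

section \<open>Nilradicals between that of one simple root and its optimisation\<close>

lemma mats_in_mono: "R \<subseteq> R' \<Longrightarrow> mats_in n R \<subseteq> mats_in n R'"
  by (auto simp: mats_in_def)

lemma nil_roots_mono: "K \<subseteq> K' \<Longrightarrow> nil_roots n K \<subseteq> nil_roots n K'"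
  by (auto simp: nil_roots_def)

lemma nil_of_mono:
  assumes "K \<subseteq> K'" "K' \<subseteq> {1..n}"
  shows "nil_of n (simple_root ` K) \<subseteq> nil_of n (simple_root ` K')"
  using assms by (simp add: nil_of_eq mats_in_mono nil_roots_mono)

lemma nilradical_obtain:
  assumes "nilradical n N"
  obtains K where "K \<subseteq> {1..n}" "K \<noteq> {}" "N = nil_of n (simple_root ` K)"
  using assms unfolding nilradical_def simple_roots_def by (metis image_is_empty subset_image_iff)

lemma cascade_root_eq:
  assumes "1 \<le> i" "i \<le> (n + 1) div 2"
  shows "cascade_root n i = rt (i - 1) (n + 1 - i)"
proof -
  have "{i..n + 1 - i} = {i - 1<..n + 1 - i}"
    using assms by auto
  then show ?thesis
    using assms by (simp add: cascade_root_def sum_simple_roots)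
qed

text \<open>The cascade root \<open>\<beta>\<^sub>i\<close> contains \<open>\<alpha>\<^sub>k\<close>
  exactly for \<open>i \<le> min k (n + 1 - k)\<close>. The sets \<open>cascade_Phi n i\<close> for
  these \<open>i\<close> collect the simple roots that are at most as far from an end of the Dynkin
  diagram as \<open>\<alpha>\<^sub>k\<close>.\<close>

lemma optimisation_single:
  assumes "k \<in> {1..n}"
  shows "optimisation n (nil_of n {simple_root k}) =
    nil_of n (simple_root ` {j \<in> {1..n}. min j (n + 1 - j) \<le> min k (n + 1 - k)})"
proof -
  let ?m = "min k (n + 1 - k)"
  have "roots_of n (nil_of n {simple_root k}) = nil_roots n {k}"
    using roots_of_nil_of[of "{k}" n] assms by simp
  moreover have cascade: "cascade_root n i \<in> nil_roots n {k} \<longleftrightarrow> i \<le> ?m"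
    if i: "1 \<le> i" "i \<le> (n + 1) div 2" for i
  proof -
    have "i - 1 < n + 1 - i"
      using i by linarith
    then have "cascade_root n i \<in> nil_roots n {k} \<longleftrightarrow> n + 1 - i \<le> n \<and> i - 1 < k \<and> k \<le> n + 1 - i"
      using i by (simp add: cascade_root_eq rt_in_nil_roots)
    also have "\<dots> \<longleftrightarrow> i \<le> ?m"
      using i assms by auto
    finally show ?thesis .
  qed
  moreover have "?m \<le> (n + 1) div 2"
    by linarith
  ultimately have "i \<in> {1..(n + 1) div 2} \<and> cascade_root n i \<in> roots_of n (nil_of n {simple_root k}) \<longleftrightarrow>
      i \<in> {1..?m}" for i
    by (cases "1 \<le> i \<and> i \<le> (n + 1) div 2") auto
  then have "{i \<in> {1..(n + 1) div 2}. cascade_root n i \<in> roots_of n (nil_of n {simple_root k})} = {1..?m}"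
    by blast
  moreover have "(\<Union>i\<in>{1..?m}. cascade_Phi n i) = simple_root ` (\<Union>i\<in>{1..?m}. {i, n + 1 - i})"
    by (auto simp: cascade_Phi_def)
  moreover have "(\<Union>i\<in>{1..?m}. {i, n + 1 - i}) = {j \<in> {1..n}. min j (n + 1 - j) \<le> ?m}"
  proof (intro equalityI subsetI)
    fix j assume "j \<in> {j \<in> {1..n}. min j (n + 1 - j) \<le> ?m}"
    then show "j \<in> (\<Union>i\<in>{1..?m}. {i, n + 1 - i})"
      by (cases "j \<le> n + 1 - j") (auto intro!: bexI[of _ "min j (n + 1 - j)"])
  qed (use assms in auto)
  ultimately show ?thesis
    by (simp add: optimisation_def)
qed

text \<open>The quantity \<open>min j (n + 1 - j)\<close> measures the distance of \<open>j\<close>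
  from the nearer end of the Dynkin diagram; a maximum over the finite set \<open>K\<close>
  exists.\<close>

lemma exists_central:
  fixes n :: nat
  assumes "K \<subseteq> {1..n}" "K \<noteq> {}"
  obtains k where "k \<in> K" "\<And>j. j \<in> K \<Longrightarrow> min j (n + 1 - j) \<le> min k (n + 1 - k)"
proof -
  define d where "d j = min j (n + 1 - j)" for j
  have fin: "finite (d ` K)"
    using finite_subset[OF assms(1)] by simp
  then have "Max (d ` K) \<in> d ` K"
    using assms(2) by (intro Max_in) auto
  then obtain k where k: "Max (d ` K) = d k" "k \<in> K"
    by (rule imageE)
  have "d j \<le> d k" if "j \<in> K" for j
    using Max_ge[OF fin, of "d j"] k(1) that by simp
  then show ?thesis
    using k(2) by (intro that[of k]) (auto simp: d_def)
qed

lemma nil_of_between: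
  assumes K: "K \<subseteq> {1..n}" and k: "k \<in> K" "\<And>j. j \<in> K \<Longrightarrow> min j (n + 1 - j) \<le> min k (n + 1 - k)"
  shows "nil_of n {simple_root k} \<subseteq> nil_of n (simple_root ` K)"
    and "nil_of n (simple_root ` K) \<subseteq> optimisation n (nil_of n {simple_root k})"
proof -
  show "nil_of n {simple_root k} \<subseteq> nil_of n (simple_root ` K)"
    using nil_of_mono[of "{k}" K n] K k(1) by simp
  have "K \<subseteq> {j \<in> {1..n}. min j (n + 1 - j) \<le> min k (n + 1 - k)}"
    using K k(2) by blast
  moreover have "k \<in> {1..n}"
    using K k(1) by blast
  ultimately show "nil_of n (simple_root ` K) \<subseteq> optimisation n (nil_of n {simple_root k})"
    unfolding optimisation_single[OF \<open>k \<in> {1..n}\<close>] by (intro nil_of_mono) auto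
qed

text \<open>These are the conditions of the locale \<open>block_roots\<close>. For the second one, a
  root of the nilradical contains some \<open>\<alpha>\<^sub>j\<close> with
  \<open>j \<le> m\<close>, which forces \<open>a < m\<close>, or with
  \<open>n + 1 - j \<le> m\<close>, which forces \<open>n + 1 - m \<le> b\<close>.\<close>

lemma nil_roots_between:
  assumes K: "K \<subseteq> {1..n}" and k: "k \<in> K" "\<And>j. j \<in> K \<Longrightarrow> min j (n + 1 - j) \<le> min k (n + 1 - k)"
    and m: "m = min k (n + 1 - k)"
  shows "\<And>a b. a < m \<Longrightarrow> n + 1 - m \<le> b \<Longrightarrow> b \<le> n \<Longrightarrow> rt a b \<in> nil_roots n K"
    and "\<And>a b. a < b \<Longrightarrow> rt a b \<in> nil_roots n K \<Longrightarrow> b \<le> n \<and> (a < m \<or> n + 1 - m \<le> b)"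
proof -
  have kn: "1 \<le> k" "k \<le> n"
    using K k(1) by auto
  fix a b
  show "rt a b \<in> nil_roots n K" if ab: "a < m" "n + 1 - m \<le> b" "b \<le> n"
  proof -
    have "a < k" "k \<le> b"
      using ab kn m by linarith+
    then show ?thesis
      using k(1) ab(3) rt_in_nil_roots[of a b n K] by auto
  qed
  show "b \<le> n \<and> (a < m \<or> n + 1 - m \<le> b)" if ab: "a < b" "rt a b \<in> nil_roots n K"
  proof -
    obtain j where j: "j \<in> K" "a < j" "j \<le> b" "b \<le> n"
      using ab by (auto simp: rt_in_nil_roots)
    have "min j (n + 1 - j) \<le> m"
      using k(2)[OF j(1)] m by simp
    then show ?thesis
      using j(2-4) by linarith
  qed
qed


section \<open>The coadjoint action in coordinates\<close>

lemma pow_strict_upper: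
  assumes X: "X \<in> strict_upper n" and ij: "j \<le> i" "i \<le> n"
  shows "(X ^\<^sub>m Suc k) $$ (i, j) = 0"
  using ij
proof (induction k arbitrary: j)
  case 0
  then show ?case
    using X by (simp add: strict_upper_def sl_def)
next
  case (Suc k)
  have carr: "X \<in> carrier_mat (n + 1) (n + 1)"
    using X by (simp add: strict_upper_def sl_def)
  have "(X ^\<^sub>m Suc (Suc k)) $$ (i, j) = (\<Sum>l\<in>{0..<n + 1}. (X ^\<^sub>m Suc k) $$ (i, l) * X $$ (l, j))"
    using carr Suc.prems pow_carrier_mat[OF carr, of "Suc k"] by (simp add: scalar_prod_def del: pow_mat.simps(2) add: pow_mat.simps(2)[of X "Suc k"])
  also have "\<dots> = 0"
  proof (intro sum.neutral ballI)
    fix l assume l: "l \<in> {0..<n + 1}"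
    show "(X ^\<^sub>m Suc k) $$ (i, l) * X $$ (l, j) = 0"
    proof (cases "l \<le> i")
      case True
      then show ?thesis
        using Suc.IH[of l] Suc.prems by simp
    next
      case False
      then show ?thesis
        using X Suc.prems l by (auto simp: strict_upper_def)
    qed
  qed
  finally show ?case .
qed

definition unitri :: "nat \<Rightarrow> complex mat \<Rightarrow> bool" where
  "unitri n g \<longleftrightarrow> g \<in> carrier_mat (n + 1) (n + 1) \<and> (\<forall>i\<le>n. g $$ (i, i) = 1) \<and> (\<forall>i\<le>n. \<forall>j<i. g $$ (i, j) = 0)"

text \<open>On and below the diagonal only the term \<open>k = 0\<close> of the exponential series
  is nonzero.\<close>

lemma unitri_unip:
  assumes "g \<in> unip n"
  shows "unitri n g"
proof -
  obtain X where X: "X \<in> strict_upper n" "g = mat_exp X"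
    using assms by (auto simp: unip_def)
  have carr: "X \<in> carrier_mat (n + 1) (n + 1)"
    using X by (simp add: strict_upper_def sl_def)
  have "g $$ (i, j) = (if i = j then 1 else 0)" if ij: "j \<le> i" "i \<le> n" for i j
  proof -
    have "(X ^\<^sub>m k) $$ (i, j) / fact k = (if k = 0 then (if i = j then 1 else 0) else 0)" for k
      using pow_strict_upper[OF X(1) ij] ij carr by (cases k) auto
    then have "suminf (\<lambda>k. (X ^\<^sub>m k) $$ (i, j) / fact k) = (if i = j then 1 else (0::complex))"
      using suminf_finite[of "{0}" "\<lambda>k. (X ^\<^sub>m k) $$ (i, j) / fact k"] ij carr by simp
    then show ?thesis
      using ij carr by (simp add: X(2) mat_exp_def)
  qed
  then show ?thesis
    using carr by (auto simp: unitri_def X(2) mat_exp_def)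
qed

text \<open>The elimination below uses only exponentials of this kind, so the series stops after two
  terms.\<close>

lemma mat_exp_square_zero:
  assumes "X \<in> carrier_mat N N" "X * X = 0\<^sub>m N N"
  shows "mat_exp X = 1\<^sub>m N + X"
proof (rule eq_matI)
  show "dim_row (mat_exp X) = dim_row (1\<^sub>m N + X)" "dim_col (mat_exp X) = dim_col (1\<^sub>m N + X)"
    using assms(1) by (auto simp: mat_exp_def)
  fix i j assume "i < dim_row (1\<^sub>m N + X)" "j < dim_col (1\<^sub>m N + X)"
  then have ij: "i < N" "j < N"
    using assms(1) by auto
  have zero: "X ^\<^sub>m Suc (Suc k) = 0\<^sub>m N N" for k
    using assms by (induction k) auto
  have "(X ^\<^sub>m k) $$ (i, j) / fact k = 0" if "k \<notin> {0, 1}" for k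
    using zero[of "k - 2"] that ij by (cases k rule: nat.exhaust; cases "k - 1") auto
  then have "suminf (\<lambda>k. (X ^\<^sub>m k) $$ (i, j) / fact k) = (\<Sum>k\<in>{0, 1}. (X ^\<^sub>m k) $$ (i, j) / fact k)"
    by (intro suminf_finite) auto
  then show "mat_exp X $$ (i, j) = (1\<^sub>m N + X) $$ (i, j)"
    using ij assms(1) by (simp add: mat_exp_def)
qed

lemma unitri_inverse:
  assumes "unitri n g"
  defines "h \<equiv> the (mat_inverse g)"
  shows "g * h = 1\<^sub>m (n + 1)" "h * g = 1\<^sub>m (n + 1)" "unitri n h"
proof -
  have g: "g \<in> carrier_mat (n + 1) (n + 1)" "\<And>i. i \<le> n \<Longrightarrow> g $$ (i, i) = 1"
      "\<And>i j. i \<le> n \<Longrightarrow> j < i \<Longrightarrow> g $$ (i, j) = 0"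
    using assms(1) by (auto simp: unitri_def)
  have "upper_triangular g"
    using g(1,3) by (auto simp: upper_triangular_def)
  moreover have "diag_mat g = map (\<lambda>_. 1) [0..<n + 1]"
    unfolding diag_mat_def using g(1,2) by (auto simp del: upt_Suc)
  ultimately have "det g = 1"
    using det_upper_triangular[of g "n + 1"] g(1) by (simp add: map_replicate_const)
  then have unit: "g \<in> Units (ring_mat TYPE(complex) (n + 1) ())"
    using det_non_zero_imp_unit[OF g(1)] by simp
  then obtain h' where h': "mat_inverse g = Some h'"
    using mat_inverse(1)[OF g(1), of "()"] by (cases "mat_inverse g") auto
  then have "h = h'"
    by (simp add: h_def)
  then have h: "g * h = 1\<^sub>m (n + 1)" "h * g = 1\<^sub>m (n + 1)" "h \<in> carrier_mat (n + 1) (n + 1)"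
    using mat_inverse(2)[OF g(1) h'] by auto
  then show "g * h = 1\<^sub>m (n + 1)" "h * g = 1\<^sub>m (n + 1)"
    by auto
  have prod: "(\<Sum>k\<in>{0..<n + 1}. g $$ (i, k) * h $$ (k, j)) = (if i = j then 1 else 0)"
    if "i \<le> n" "j \<le> n" for i j
  proof -
    have "(g * h) $$ (i, j) = (\<Sum>k\<in>{0..<n + 1}. g $$ (i, k) * h $$ (k, j))"
      using g(1) h(3) that by (simp add: scalar_prod_def del: sum.op_ivl_Suc)
    then show ?thesis
      using that by (simp add: h(1))
  qed
  \<comment> \<open>Back substitution: if column \<open>j\<close> of \<open>h\<close> vanishes below
    row \<open>i\<close>, row \<open>i\<close> of \<open>g * h = 1\<close> involves only
    \<open>h $$ (i, j)\<close>.\<close>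
  have step: "h $$ (i, j) = (if i = j then 1 else 0)"
    if ij: "i \<le> n" "j \<le> n" and below: "\<And>k. i < k \<Longrightarrow> k \<le> n \<Longrightarrow> h $$ (k, j) = 0" for i j
  proof -
    have "(\<Sum>k\<in>{0..<n + 1}. g $$ (i, k) * h $$ (k, j)) = (\<Sum>k\<in>{0..<n + 1}. if k = i then h $$ (k, j) else 0)"
    proof (rule sum.cong[OF refl])
      fix k assume "k \<in> {0..<n + 1}"
      then show "g $$ (i, k) * h $$ (k, j) = (if k = i then h $$ (k, j) else 0)"
        using g(2,3)[of i] below[of k] ij by (cases k i rule: linorder_cases) auto
    qed
    then show ?thesis
      using prod[OF ij] ij by (simp del: sum.op_ivl_Suc)
  qed
  have lower: "h $$ (i, j) = 0" if "i \<le> n" "j < i" for i j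
    using that
  proof (induction "n - i" arbitrary: i rule: less_induct)
    case less
    then show ?case
      using step[of i j] by simp
  qed
  then have "h $$ (i, i) = 1" if "i \<le> n" for i
    using step[of i i] that by simp
  then show "unitri n h"
    using h(3) lower by (simp add: unitri_def)
qed

text \<open>A point \<open>v\<close> stands for the linear form on matrices with the value \<open>v (rt a b)\<close> at the matrix
  unit \<open>(a, b)\<close>; \<open>pull n g v\<close> is its composition with \<open>Ad g\<close>.\<close>

definition pull :: "nat \<Rightarrow> complex mat \<Rightarrow> (wt \<Rightarrow> complex) \<Rightarrow> wt \<Rightarrow> complex" where
  "pull n g v \<gamma> = pev v (emb n (Ad g (root_vector n \<gamma>)))"

lemma pev_act: "pev v (act n g p) = pev (pull n g v) p"
  by (simp add: act_def pev_poly_subst pull_def[abs_def])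

lemma pev_emb: "pev v (emb n X) = (\<Sum>i<n + 1. \<Sum>j<n + 1. X $$ (i, j) * v (rt i j))"
  by (simp add: emb_def pev_sum pev_mult rt_def del: sum.lessThan_Suc)

text \<open>\<open>Ad g\<close> maps the matrix unit at \<open>(a, b)\<close> to column
  \<open>a\<close> of \<open>g\<close> times row \<open>b\<close> of the inverse.\<close>

lemma pull_rt:
  assumes "unitri n g" "a \<le> n" "b \<le> n" "a \<noteq> b"
  defines "h \<equiv> the (mat_inverse g)"
  shows "pull n g v (rt a b) = (\<Sum>i<n + 1. \<Sum>j<n + 1. g $$ (i, a) * h $$ (b, j) * v (rt i j))"
proof -
  have carr: "g \<in> carrier_mat (n + 1) (n + 1)" "h \<in> carrier_mat (n + 1) (n + 1)"
    using assms(1) unitri_inverse(3)[OF assms(1)] by (auto simp: unitri_def h_def)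
  let ?E = "root_vector n (rt a b)"
  have E: "?E = mat (n + 1) (n + 1) (\<lambda>(i, j). if i = a \<and> j = b then 1 else 0)"
    unfolding root_vector_def using rt_inj[OF assms(4)] by (auto simp: rt_def)
  have gE: "(g * ?E) $$ (i, l) = (if l = b then g $$ (i, a) else 0)" if "i < n + 1" "l < n + 1" for i l
  proof -
    have "(g * ?E) $$ (i, l) = (\<Sum>k\<in>{0..<n + 1}. g $$ (i, k) * ?E $$ (k, l))"
      using carr that by (simp add: scalar_prod_def E del: sum.op_ivl_Suc)
    also have "\<dots> = (\<Sum>k\<in>{0..<n + 1}. if k = a then (if l = b then g $$ (i, k) else 0) else 0)"
      using that by (intro sum.cong) (auto simp: E)
    finally show ?thesis
      using assms(2) by simp
  qed
  have "Ad g ?E $$ (i, j) = g $$ (i, a) * h $$ (b, j)" if "i < n + 1" "j < n + 1" for i j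
  proof -
    have "Ad g ?E $$ (i, j) = (\<Sum>l\<in>{0..<n + 1}. (g * ?E) $$ (i, l) * h $$ (l, j))"
      using carr that by (simp add: Ad_def h_def[symmetric] scalar_prod_def E del: sum.op_ivl_Suc)
    also have "\<dots> = (\<Sum>l\<in>{0..<n + 1}. if l = b then g $$ (i, a) * h $$ (l, j) else 0)"
      using gE that by (intro sum.cong) auto
    finally show ?thesis
      using assms(3) by simp
  qed
  then show ?thesis
    unfolding pull_def pev_emb by (intro sum.cong refl) auto
qed

text \<open>Here \<open>mat_exp X\<close> is \<open>1 + X\<close> with inverse \<open>1 - X\<close>;
  the four terms come from expanding the product in \<open>pull_rt\<close>.\<close>

lemma pull_square_zero:
  assumes X: "X \<in> strict_upper n" "X * X = 0\<^sub>m (n + 1) (n + 1)" and ab: "a \<le> n" "b \<le> n" "a \<noteq> b"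
  shows "pull n (mat_exp X) v (rt a b) = v (rt a b) + (\<Sum>i<n + 1. X $$ (i, a) * v (rt i b))
    - (\<Sum>j<n + 1. X $$ (b, j) * v (rt a j)) - (\<Sum>i<n + 1. \<Sum>j<n + 1. X $$ (i, a) * X $$ (b, j) * v (rt i j))"
proof -
  let ?N = "n + 1"
  define g where "g = mat_exp X"
  define h where "h = the (mat_inverse g)"
  have carr: "X \<in> carrier_mat ?N ?N"
    using X by (simp add: strict_upper_def sl_def)
  have g: "g = 1\<^sub>m ?N + X"
    using mat_exp_square_zero[OF carr X(2)] by (simp add: g_def)
  have uni: "unitri n g"
    using X(1) by (intro unitri_unip) (auto simp: unip_def g_def)
  have hc: "h \<in> carrier_mat ?N ?N" "h * g = 1\<^sub>m ?N"
    using unitri_inverse[OF uni] by (auto simp: h_def unitri_def)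
  have "g * (1\<^sub>m ?N - X) = 1\<^sub>m ?N"
  proof -
    have "g * (1\<^sub>m ?N - X) = g * 1\<^sub>m ?N - g * X"
      using carr g by (intro mult_minus_distrib_mat) auto
    also have "g * X = X"
      unfolding g using carr X(2) by (subst add_mult_distrib_mat[of _ ?N ?N]) auto
    finally show ?thesis
      unfolding g using carr by (auto intro!: eq_matI)
  qed
  then have "h = h * (g * (1\<^sub>m ?N - X))"
    using hc(1) by simp
  also have "\<dots> = h * g * (1\<^sub>m ?N - X)"
    using hc(1) carr g by (intro assoc_mult_mat[symmetric]) auto
  also have "\<dots> = 1\<^sub>m ?N - X"
    unfolding hc(2) using carr by (intro left_mult_one_mat) auto
  finally have h: "h = 1\<^sub>m ?N - X" .
  have "pull n g v (rt a b) = (\<Sum>i<?N. \<Sum>j<?N. g $$ (i, a) * h $$ (b, j) * v (rt i j))"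
    unfolding h_def by (rule pull_rt[OF uni ab])
  also have "\<dots> = (\<Sum>i<?N. \<Sum>j<?N.
      ((if i = a then (if j = b then v (rt i j) else 0) else 0) + (if j = b then X $$ (i, a) * v (rt i j) else 0))
      - (if i = a then X $$ (b, j) * v (rt i j) else 0) - X $$ (i, a) * X $$ (b, j) * v (rt i j))"
    using ab carr by (intro sum.cong refl) (auto simp: g h algebra_simps)
  also have "\<dots> = v (rt a b) + (\<Sum>i<?N. X $$ (i, a) * v (rt i b)) - (\<Sum>j<?N. X $$ (b, j) * v (rt a j))
      - (\<Sum>i<?N. \<Sum>j<?N. X $$ (i, a) * X $$ (b, j) * v (rt i j))"
  proof -
    have "(\<Sum>i<?N. \<Sum>j<?N. if i = a then (if j = b then v (rt i j) else 0) else 0) =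
        (\<Sum>i<?N. if i = a then (\<Sum>j<?N. if j = b then v (rt i j) else 0) else 0)"
      by (intro sum.cong) (auto simp del: sum.lessThan_Suc)
    also have "\<dots> = v (rt a b)"
      using ab by (simp del: sum.lessThan_Suc)
    finally have 1: "(\<Sum>i<?N. \<Sum>j<?N. if i = a then (if j = b then v (rt i j) else 0) else 0) = v (rt a b)" .
    have 2: "(\<Sum>i<?N. \<Sum>j<?N. if j = b then X $$ (i, a) * v (rt i j) else 0) = (\<Sum>i<?N. X $$ (i, a) * v (rt i b))"
      using ab by (simp del: sum.lessThan_Suc)
    have 3: "(\<Sum>i<?N. \<Sum>j<?N. if i = a then X $$ (b, j) * v (rt i j) else 0) = (\<Sum>j<?N. X $$ (b, j) * v (rt a j))"
      using ab by (subst sum.swap) (simp del: sum.lessThan_Suc)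
    show ?thesis
      unfolding sum_subtractf sum.distrib 1 2 3 ..
  qed
  finally show ?thesis
    by (simp add: g_def)
qed

text \<open>On the array of values \<open>v (rt a b)\<close> this subtracts multiples of column
  \<open>z\<close> from the columns strictly between \<open>k\<close> and \<open>z\<close>; the
  other term changes row \<open>z\<close> only.\<close>

lemma exp_column:
  assumes X: "X = mat (n + 1) (n + 1) (\<lambda>(i, j). if j = z \<and> k < i \<and> i < z then x i else 0)"
    and z: "z \<le> n"
  shows "X \<in> strict_upper n" "X * X = 0\<^sub>m (n + 1) (n + 1)"
    and "a < b \<Longrightarrow> b \<le> n \<Longrightarrow> pull n (mat_exp X) v (rt a b) = v (rt a b)
      + (if a = z then \<Sum>i\<in>{k<..<z}. x i * v (rt i b) else 0) - (if k < b \<and> b < z then x b * v (rt a z) else 0)"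
proof -
  show su: "X \<in> strict_upper n"
    by (auto simp: X strict_upper_def sl_def simp del: sum.lessThan_Suc intro!: sum.neutral)
  show sq: "X * X = 0\<^sub>m (n + 1) (n + 1)"
    by (rule eq_matI) (auto simp: X scalar_prod_def intro!: sum.neutral)
  assume ab: "a < b" "b \<le> n"
  have "(\<Sum>i<n + 1. X $$ (i, a) * v (rt i b)) = (if a = z then \<Sum>i\<in>{k<..<z}. x i * v (rt i b) else 0)"
  proof (cases "a = z")
    case True
    have "(\<Sum>i<n + 1. X $$ (i, a) * v (rt i b)) = (\<Sum>i<n + 1. if i \<in> {k<..<z} then x i * v (rt i b) else 0)"
      using ab True by (intro sum.cong) (auto simp: X)
    also have "\<dots> = (\<Sum>i\<in>{k<..<z}. x i * v (rt i b))"
      using z by (intro sum.mono_neutral_cong_right) auto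
    finally show ?thesis
      using True by simp
  qed (use ab in \<open>auto simp: X intro!: sum.neutral\<close>)
  moreover have "(\<Sum>j<n + 1. X $$ (b, j) * v (rt a j)) = (if k < b \<and> b < z then x b * v (rt a z) else 0)"
  proof -
    have "(\<Sum>j<n + 1. X $$ (b, j) * v (rt a j)) =
        (\<Sum>j<n + 1. if j = z then (if k < b \<and> b < z then x b * v (rt a z) else 0) else 0)"
      using ab by (intro sum.cong) (auto simp: X)
    then show ?thesis
      using z by simp
  qed
  \<comment> \<open>A nonzero quadratic term needs \<open>a = z\<close> and \<open>b < z\<close>,
    against \<open>a < b\<close>.\<close>
  moreover have "(\<Sum>i<n + 1. \<Sum>j<n + 1. X $$ (i, a) * X $$ (b, j) * v (rt i j)) = 0"
    using ab by (intro sum.neutral ballI) (auto simp: X)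
  ultimately show "pull n (mat_exp X) v (rt a b) = v (rt a b)
      + (if a = z then \<Sum>i\<in>{k<..<z}. x i * v (rt i b) else 0) - (if k < b \<and> b < z then x b * v (rt a z) else 0)"
    using pull_square_zero[OF su sq, of a b v] ab by simp
qed

text \<open>The dual operation: multiples of row \<open>k\<close> are added to the rows strictly
  between \<open>k\<close> and \<open>z\<close>, and otherwise only column \<open>k\<close> changes.
  A nonzero quadratic term would need \<open>k < a\<close> and \<open>b = k\<close>.\<close>

lemma exp_row:
  assumes X: "X = mat (n + 1) (n + 1) (\<lambda>(i, j). if i = k \<and> k < j \<and> j < z then y j else 0)"
    and z: "k < z" "z \<le> n"
  shows "X \<in> strict_upper n" "X * X = 0\<^sub>m (n + 1) (n + 1)"
    and "a < b \<Longrightarrow> b \<le> n \<Longrightarrow> pull n (mat_exp X) v (rt a b) = v (rt a b)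
      + (if k < a \<and> a < z then y a * v (rt k b) else 0) - (if b = k then \<Sum>j\<in>{k<..<z}. y j * v (rt a j) else 0)"
proof -
  show su: "X \<in> strict_upper n"
    by (auto simp: X strict_upper_def sl_def simp del: sum.lessThan_Suc intro!: sum.neutral)
  show sq: "X * X = 0\<^sub>m (n + 1) (n + 1)"
    by (rule eq_matI) (auto simp: X scalar_prod_def intro!: sum.neutral)
  assume ab: "a < b" "b \<le> n"
  have "(\<Sum>i<n + 1. X $$ (i, a) * v (rt i b)) = (if k < a \<and> a < z then y a * v (rt k b) else 0)"
  proof -
    have "(\<Sum>i<n + 1. X $$ (i, a) * v (rt i b)) =
        (\<Sum>i<n + 1. if i = k then (if k < a \<and> a < z then y a * v (rt k b) else 0) else 0)"
      using ab by (intro sum.cong) (auto simp: X)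
    then show ?thesis
      using z by simp
  qed
  moreover have "(\<Sum>j<n + 1. X $$ (b, j) * v (rt a j)) = (if b = k then \<Sum>j\<in>{k<..<z}. y j * v (rt a j) else 0)"
  proof (cases "b = k")
    case True
    have "(\<Sum>j<n + 1. X $$ (b, j) * v (rt a j)) = (\<Sum>j<n + 1. if j \<in> {k<..<z} then y j * v (rt a j) else 0)"
      using ab True by (intro sum.cong) (auto simp: X)
    also have "\<dots> = (\<Sum>j\<in>{k<..<z}. y j * v (rt a j))"
      using z by (intro sum.mono_neutral_cong_right) auto
    finally show ?thesis
      using True by simp
  qed (use ab in \<open>auto simp: X intro!: sum.neutral\<close>)
  moreover have "(\<Sum>i<n + 1. \<Sum>j<n + 1. X $$ (i, a) * X $$ (b, j) * v (rt i j)) = 0"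
    using ab by (intro sum.neutral ballI) (auto simp: X)
  ultimately show "pull n (mat_exp X) v (rt a b) = v (rt a b)
      + (if k < a \<and> a < z then y a * v (rt k b) else 0) - (if b = k then \<Sum>j\<in>{k<..<z}. y j * v (rt a j) else 0)"
    using pull_square_zero[OF su sq, of a b v] ab by simp
qed


section \<open>Corner minors and Gaussian elimination\<close>

text \<open>The rows and columns of the corner block are arranged such that the entries on the diagonal of
  the matrix belong to the roots of the Kostant cascade.\<close>

definition minor :: "nat \<Rightarrow> nat \<Rightarrow> spoly" where
  "minor n i = det (mat i i (\<lambda>(r, s). Var (rt s (n - r))))"

lemma pev_minor: "pev v (minor n i) = det (mat i i (\<lambda>(r, s). v (rt s (n - r))))"
proof -
  interpret comm_ring_hom "pev v"
    by (rule comm_ring_hom_pev)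
  have "map_mat (pev v) (mat i i (\<lambda>(r, s). Var (rt s (n - r)))) = mat i i (\<lambda>(r, s). v (rt s (n - r)))"
    by (rule eq_matI) auto
  then show ?thesis
    unfolding minor_def hom_det[symmetric] by simp
qed

text \<open>Triangularity of \<open>g\<close> and its inverse \<open>h\<close> keeps the sums inside
  the corner. The corner matrix is therefore multiplied from both sides by unitriangular matrices,
  which have determinant 1. The bound on \<open>i\<close> keeps the corner strictly above the
  diagonal.\<close>

lemma pev_minor_pull:
  assumes "unitri n g" "2 * i \<le> n + 1"
  shows "pev (pull n g v) (minor n i) = pev v (minor n i)"
proof -
  define h where "h = the (mat_inverse g)"
  have h: "unitri n h"
    unfolding h_def by (rule unitri_inverse(3)[OF assms(1)])
  define L where "L = mat i i (\<lambda>(r, q). h $$ (n - r, n - q))"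
  define M where "M = mat i i (\<lambda>(q, a). v (rt a (n - q)))"
  define R where "R = mat i i (\<lambda>(a, s). g $$ (a, s))"
  have LMR: "L \<in> carrier_mat i i" "M \<in> carrier_mat i i" "R \<in> carrier_mat i i"
    by (auto simp: L_def M_def R_def)
  have "mat i i (\<lambda>(r, s). pull n g v (rt s (n - r))) = L * M * R"
  proof (rule eq_matI)
    show "dim_row (mat i i (\<lambda>(r, s). pull n g v (rt s (n - r)))) = dim_row (L * M * R)"
      "dim_col (mat i i (\<lambda>(r, s). pull n g v (rt s (n - r)))) = dim_col (L * M * R)"
      by (auto simp: L_def R_def)
    fix r s assume "r < dim_row (L * M * R)" "s < dim_col (L * M * R)"
    then have rs: "r < i" "s < i"
      by (auto simp: L_def R_def)
    have "pull n g v (rt s (n - r)) = (\<Sum>a<n + 1. \<Sum>b<n + 1. g $$ (a, s) * h $$ (n - r, b) * v (rt a b))"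
      unfolding h_def using rs assms(2) by (intro pull_rt[OF assms(1)]) auto
    also have "\<dots> = (\<Sum>a<i. \<Sum>b<n + 1. g $$ (a, s) * h $$ (n - r, b) * v (rt a b))"
      using assms rs by (intro sum.mono_neutral_right) (auto simp: unitri_def intro!: sum.neutral)
    also have "\<dots> = (\<Sum>a<i. \<Sum>q<i. L $$ (r, q) * M $$ (q, a) * R $$ (a, s))"
    proof (rule sum.cong[OF refl])
      fix a assume a: "a \<in> {..<i}"
      \<comment> \<open>Columns are counted from the last one, \<open>b = n - q\<close>. Row
        \<open>n - r\<close> of \<open>h\<close> vanishes left of its diagonal, that is for
        \<open>q > r\<close>.\<close>
      have "(\<Sum>b<n + 1. g $$ (a, s) * h $$ (n - r, b) * v (rt a b)) =
          (\<Sum>q<n + 1. g $$ (a, s) * h $$ (n - r, n - q) * v (rt a (n - q)))"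
        using sum.nat_diff_reindex[of "\<lambda>b. g $$ (a, s) * h $$ (n - r, b) * v (rt a b)" "n + 1"]
        by (simp del: sum.lessThan_Suc)
      also have "\<dots> = (\<Sum>q<i. g $$ (a, s) * h $$ (n - r, n - q) * v (rt a (n - q)))"
        using assms(2) h rs by (intro sum.mono_neutral_right) (auto simp: unitri_def)
      also have "\<dots> = (\<Sum>q<i. L $$ (r, q) * M $$ (q, a) * R $$ (a, s))"
        using rs a by (intro sum.cong) (auto simp: L_def M_def R_def)
      finally show "(\<Sum>b<n + 1. g $$ (a, s) * h $$ (n - r, b) * v (rt a b)) =
          (\<Sum>q<i. L $$ (r, q) * M $$ (q, a) * R $$ (a, s))" .
    qed
    also have "\<dots> = (L * M * R) $$ (r, s)"
      using rs LMR by (simp add: scalar_prod_def sum_distrib_left atLeast0LessThan mult.assoc) (rule sum.swap)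
    finally show "mat i i (\<lambda>(r, s). pull n g v (rt s (n - r))) $$ (r, s) = (L * M * R) $$ (r, s)"
      using rs by simp
  qed
  moreover have "det L = 1"
  proof -
    have "L $$ (r, q) = 0" if "r < q" "q < i" for r q
      using that assms(2) h by (auto simp: L_def unitri_def)
    then have "det L = prod_list (diag_mat L)"
      by (intro det_lower_triangular[OF _ LMR(1)]) auto
    also have "diag_mat L = map (\<lambda>_. 1) [0..<i]"
      using assms(2) h by (auto simp: diag_mat_def L_def unitri_def)
    finally show ?thesis
      by (simp add: map_replicate_const)
  qed
  moreover have "det R = 1"
  proof -
    have "det R = prod_list (diag_mat R)"
      using assms by (intro det_upper_triangular[OF _ LMR(3)]) (auto simp: R_def unitri_def)
    also have "diag_mat R = map (\<lambda>_. 1) [0..<i]"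
      using assms by (auto simp: diag_mat_def R_def unitri_def)
    finally show ?thesis
      by (simp add: map_replicate_const)
  qed
  ultimately have "det (mat i i (\<lambda>(r, s). pull n g v (rt s (n - r)))) = det M"
    using LMR by (simp add: det_mult[of _ i])
  then show ?thesis
    by (simp add: pev_minor M_def)
qed

lemma act_minor:
  assumes "g \<in> unip n" "2 * i \<le> n + 1"
  shows "act n g (minor n i) = minor n i"
  using assms by (intro poly_eqI_pev) (simp add: pev_act pev_minor_pull unitri_unip)

text \<open>The state of the elimination after the first \<open>k\<close> rows and the last \<open>k\<close> columns.\<close>

definition clean :: "nat \<Rightarrow> nat \<Rightarrow> (wt \<Rightarrow> complex) \<Rightarrow> bool" where
  "clean n k v \<longleftrightarrow> (\<forall>a b. a < b \<and> b \<le> n \<and> (a < k \<or> n - k < b) \<and> a + b \<noteq> n \<longrightarrow> v (rt a b) = 0)"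

text \<open>Of two distinct indices in a corner of size at most \<open>k + 1\<close> one is below
  \<open>k\<close>, so every entry off the diagonal has been cleared already.\<close>

lemma minor_clean:
  assumes "clean n k v" "i \<le> k + 1" "2 * i \<le> n + 1"
  shows "pev v (minor n i) = (\<Prod>r<i. v (rt r (n - r)))"
proof -
  define A where "A = mat i i (\<lambda>(r, s). v (rt s (n - r)))"
  have "A $$ (r, s) = 0" if "r < i" "s < i" "r \<noteq> s" for r s
  proof -
    have "s < n - r" "n - r \<le> n" "s < k \<or> n - k < n - r" "s + (n - r) \<noteq> n"
      using that assms(2,3) by linarith+
    then show ?thesis
      using assms(1) that by (simp add: clean_def A_def)
  qed
  then have "det A = prod_list (diag_mat A)"
    by (intro det_upper_triangular[of _ i]) (auto simp: A_def)
  also have "\<dots> = (\<Prod>r<i. A $$ (r, r))"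
    by (simp add: diag_mat_def A_def prod.list_conv_set_nth atLeast0LessThan)
  also have "\<dots> = (\<Prod>r<i. v (rt r (n - r)))"
    by (intro prod.cong) (auto simp: A_def)
  finally show ?thesis
    by (simp add: pev_minor A_def)
qed

text \<open>This follows from lying in one orbit and is transitive without composing group
  elements.\<close>

definition same_inv :: "nat \<Rightarrow> (wt \<Rightarrow> complex) \<Rightarrow> (wt \<Rightarrow> complex) \<Rightarrow> bool" where
  "same_inv n v v' \<longleftrightarrow> (\<forall>p. (\<forall>g\<in>unip n. act n g p = p) \<longrightarrow> pev v' p = pev v p)"

lemma same_inv_pull: "X \<in> strict_upper n \<Longrightarrow> same_inv n v (pull n (mat_exp X) v)"
  unfolding same_inv_def unip_def by (metis pev_act imageI)

lemma same_inv_trans: "same_inv n v v' \<Longrightarrow> same_inv n v' v'' \<Longrightarrow> same_inv n v v''"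
  by (simp add: same_inv_def)

text \<open>The pivot is the entry at \<open>(k, n - k)\<close>. A column operation clears row
  \<open>k\<close> to its left, then a row operation clears column \<open>n - k\<close> below
  it.\<close>

lemma clean_step:
  assumes "clean n k v" "2 * k < n" "v (rt k (n - k)) \<noteq> 0"
  shows "\<exists>v'. clean n (k + 1) v' \<and> same_inv n v v'"
proof -
  define z where "z = n - k"
  have z: "k < z" "z \<le> n" "k + z = n"
    using assms(2) by (auto simp: z_def)
  have cl: "v (rt a b) = 0" if "a < b" "b \<le> n" "a < k \<or> z < b" "a + b \<noteq> n" for a b
    using assms(1) that by (simp add: clean_def z_def)
  have pivot: "v (rt k z) \<noteq> 0"
    using assms(3) by (simp add: z_def)

  \<comment> \<open>Chosen so that \<open>v (rt k b) - x b * v (rt k z) = 0\<close>.\<close>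
  define x where "x b = v (rt k b) / v (rt k z)" for b
  define X where "X = mat (n + 1) (n + 1) (\<lambda>(i, j). if j = z \<and> k < i \<and> i < z then x i else 0)"
  define v1 where "v1 = pull n (mat_exp X) v"
  have v1: "v1 (rt a b) = v (rt a b)
      + (if a = z then \<Sum>i\<in>{k<..<z}. x i * v (rt i b) else 0) - (if k < b \<and> b < z then x b * v (rt a z) else 0)"
    if "a < b" "b \<le> n" for a b
    unfolding v1_def by (rule exp_column(3)[OF X_def z(2) that])
  \<comment> \<open>In the part cleaned before, the added terms come from column \<open>z\<close> in
    rows above \<open>k\<close> or from columns right of \<open>z\<close>; all these entries are
    already 0.\<close>
  have cl1: "v1 (rt a b) = 0" if ab: "a < b" "b \<le> n" "a < k \<or> z < b" "a + b \<noteq> n" for a b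
  proof -
    have "(\<Sum>i\<in>{k<..<z}. x i * v (rt i b)) = 0" if "a = z"
      using ab that z by (intro sum.neutral ballI) (auto intro!: cl)
    moreover have "v (rt a z) = 0" if "k < b" "b < z"
      using ab that z by (intro cl) auto
    ultimately show ?thesis
      using ab cl[OF ab] by (simp add: v1)
  qed
  have v1k: "v1 (rt k b) = 0" if "k < b" "b < z" for b
    using that z pivot by (simp add: v1 x_def)
  have pivot1: "v1 (rt k z) \<noteq> 0"
    using z pivot by (simp add: v1)

  \<comment> \<open>Chosen so that \<open>v1 (rt a z) + y a * v1 (rt k z) = 0\<close>.\<close>
  define y where "y a = - v1 (rt a z) / v1 (rt k z)" for a
  define Y where "Y = mat (n + 1) (n + 1) (\<lambda>(i, j). if i = k \<and> k < j \<and> j < z then y j else 0)"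
  define v2 where "v2 = pull n (mat_exp Y) v1"
  have v2: "v2 (rt a b) = v1 (rt a b)
      + (if k < a \<and> a < z then y a * v1 (rt k b) else 0) - (if b = k then \<Sum>j\<in>{k<..<z}. y j * v1 (rt a j) else 0)"
    if "a < b" "b \<le> n" for a b
    unfolding v2_def by (rule exp_row(3)[OF Y_def z(1,2) that])
  have "v2 (rt a b) = 0" if ab: "a < b" "b \<le> n" "a < k + 1 \<or> n - (k + 1) < b" "a + b \<noteq> n" for a b
  proof -
    have zb: "a < k + 1 \<or> z \<le> b"
      using ab(3) z by linarith
    have sum0: "(\<Sum>j\<in>{k<..<z}. y j * v1 (rt a j)) = 0" if "b = k"
      using ab that z by (intro sum.neutral ballI) (auto intro!: cl1)
    \<comment> \<open>The pivot itself, \<open>a = k\<close> and \<open>b = z\<close>, is ruled out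
      by \<open>a + b \<noteq> n\<close>.\<close>
    consider "a < k \<or> z < b" | "a = k" "b < z" | "a > k" "b = z"
      using ab zb z by linarith
    then show ?thesis
    proof cases
      case 1
      have "v1 (rt k b) = 0" if "k < a"
        using 1 ab that z by (intro cl1) auto
      then show ?thesis
        using cl1[OF ab(1,2) 1 ab(4)] sum0 ab by (simp add: v2)
    next
      case 2
      then show ?thesis
        using v1k[of b] ab by (simp add: v2)
    next
      case 3
      then show ?thesis
        using ab pivot1 z by (simp add: v2 y_def)
    qed
  qed
  then have "clean n (k + 1) v2"
    by (simp add: clean_def)
  moreover have "same_inv n v v1" "same_inv n v1 v2"
    unfolding v1_def v2_def
    by (auto intro!: same_inv_pull exp_column(1)[OF X_def z(2)] exp_row(1)[OF Y_def z(1,2)])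
  ultimately show ?thesis
    using same_inv_trans by blast
qed

text \<open>Minors do not change during the elimination. In a clean state the next one is a product
  of antidiagonal entries with the next pivot as its last factor, so a nonzero minor gives a nonzero
  pivot.\<close>

lemma clean_exists:
  assumes "2 * k \<le> n + 1" "\<And>i. i \<in> {1..k} \<Longrightarrow> pev v (minor n i) \<noteq> 0"
  shows "\<exists>v'. clean n k v' \<and> same_inv n v v'"
  using assms
proof (induction k)
  case 0
  have "clean n 0 v" "same_inv n v v"
    by (auto simp: clean_def same_inv_def)
  then show ?case by blast
next
  case (Suc k)
  then obtain v' where v': "clean n k v'" "same_inv n v v'"
    by fastforce
  have "pev v' (minor n (k + 1)) = pev v (minor n (k + 1))"
    using v'(2) act_minor[of _ n "k + 1"] Suc.prems(1) by (simp add: same_inv_def)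
  moreover have "pev v' (minor n (k + 1)) = (\<Prod>r<k + 1. v' (rt r (n - r)))"
    using Suc.prems(1) by (intro minor_clean[OF v'(1)]) auto
  ultimately have "v' (rt k (n - k)) \<noteq> 0"
    using Suc.prems(2)[of "k + 1"] by auto
  then show ?case
    using clean_step[OF v'(1)] v'(2) Suc.prems(1) same_inv_trans by fastforce
qed


section \<open>The invariants of a nilradical\<close>

text \<open>The square of the height, for positive roots only.\<close>

definition ht2 :: "wt \<Rightarrow> nat" where
  "ht2 \<gamma> = (case inv_into {(a, b). a < b} (\<lambda>(a, b). rt a b) \<gamma> of (a, b) \<Rightarrow> (b - a)^2)"

lemma ht2_rt:
  assumes "a < b"
  shows "ht2 (rt a b) = (b - a)^2"
proof -
  have "inj_on (\<lambda>(a, b). rt a b) {(a, b). a < b}"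
    by (auto simp: inj_on_def rt_inj)
  then have "inv_into {(a, b). a < b} (\<lambda>(a, b). rt a b) ((\<lambda>(a, b). rt a b) (a, b)) = (a, b)"
    using assms by (intro inv_into_f_f) auto
  then show ?thesis
    by (simp add: ht2_def)
qed

text \<open>These are the variables at \<open>r + s = i - 1\<close> in the matrix of
  \<open>minor\<close>, all of height \<open>n + 1 - i\<close>.\<close>

definition diag_roots :: "nat \<Rightarrow> nat \<Rightarrow> wt set" where
  "diag_roots n i = (\<lambda>s. rt s (n + 1 - i + s)) ` {..<i}"

lemma has_initial_minor:
  assumes i: "2 * i \<le> n + 1"
  shows "has_initial ht2 (\<Sum>x\<in>diag_roots n i. Poly_Mapping.single x 1) (minor n i)"
proof -
  define mon where "mon p = (\<Sum>r<i. Poly_Mapping.single (rt (p r) (n - r)) (1::nat))" for p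
  define Q where "Q = {p. p permutes {0..<i}}"
  \<comment> \<open>The reversing permutation selects the entries with \<open>r + s = i - 1\<close>,
    those of equal height.\<close>
  define p0 where "p0 r = (if r < i then i - 1 - r else r)" for r
  have finQ: "finite Q"
    unfolding Q_def by (rule finite_permutations) simp
  have p0: "p0 \<in> Q"
  proof -
    have "bij_betw p0 {0..<i} {0..<i}"
      by (rule bij_betwI[of _ _ _ p0]) (auto simp: p0_def)
    then show ?thesis
      unfolding Q_def by (auto simp: p0_def intro!: bij_imp_permutes)
  qed
  have perm: "p r < i" if "p \<in> Q" "r < i" for p r
    using that permutes_in_image[of p "{0..<i}" r] by (simp add: Q_def)
  have lt: "p r < n - r" if "p \<in> Q" "r < i" for p r
    using perm[OF that] that(2) i by linarith
  have factors: "(\<Prod>r = 0..<i. mat i i (\<lambda>(r, s). Var (rt s (n - r))) $$ (r, p r)) = Poly_Mapping.single (mon p) 1"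
    if "p \<in> Q" for p
  proof -
    have "(\<Prod>r = 0..<i. mat i i (\<lambda>(r, s). Var (rt s (n - r))) $$ (r, p r)) = (\<Prod>r\<in>{..<i}. Var (rt (p r) (n - r)))"
      using perm[OF that] by (intro prod.cong) (auto simp: atLeast0LessThan)
    also have "(\<Prod>r\<in>S. Var (rt (p r) (n - r))) =
        Poly_Mapping.single (\<Sum>r\<in>S. Poly_Mapping.single (rt (p r) (n - r)) 1) 1" for S
      by (induction S rule: infinite_finite_induct) (auto simp: Var_def mult_single)
    finally show ?thesis
      by (simp add: mon_def)
  qed
  have sign: "signof p * (Poly_Mapping.single m 1 :: spoly) = Poly_Mapping.single m (signof p)" for p :: "nat \<Rightarrow> nat" and m
    by (simp add: sign_def single_uminus)
  have minor: "minor n i = (\<Sum>p\<in>Q. Poly_Mapping.single (mon p) (signof p))"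
    unfolding minor_def det_def using factors sign by (simp add: Q_def)
  have mon_p0: "mon p0 = (\<Sum>x\<in>diag_roots n i. Poly_Mapping.single x 1)"
  proof -
    have "inj_on (\<lambda>s. rt s (n + 1 - i + s)) {..<i}"
      using i by (auto simp: inj_on_def rt_inj)
    then have "(\<Sum>x\<in>diag_roots n i. Poly_Mapping.single x (1::nat)) =
        (\<Sum>s<i. Poly_Mapping.single (rt s (n + 1 - i + s)) 1)"
      unfolding diag_roots_def by (simp add: sum.reindex)
    also have "\<dots> = (\<Sum>r<i. Poly_Mapping.single (rt (i - Suc r) (n + 1 - i + (i - Suc r))) 1)"
      by (rule sum.nat_diff_reindex[symmetric])
    also have "\<dots> = mon p0"
      unfolding mon_def using i by (intro sum.cong) (auto simp: p0_def)
    finally show ?thesis ..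
  qed
  have deg: "wgt (\<lambda>_. 1) (mon p) = i" for p
    by (simp add: mon_def wgt_sum)
  \<comment> \<open>The heights \<open>n - r - p r\<close> of the factors have a sum that does not depend on \<open>p\<close>, so the
    sum of their squares is least when they are all equal.\<close>
  define d where "d p r = int (n - r) - int (p r)" for p r
  have wgt_mon: "int (wgt ht2 (mon p)) = (\<Sum>r<i. (d p r)^2)" if "p \<in> Q" for p
  proof -
    have "int (ht2 (rt (p r) (n - r))) = (d p r)^2" if "r < i" for r
      using lt[OF \<open>p \<in> Q\<close> that] by (simp add: ht2_rt d_def of_nat_diff)
    then show ?thesis
      by (simp add: mon_def wgt_sum)
  qed
  define c where "c = int n + 1 - int i"
  have d_p0: "d p0 r = c" if "r < i" for r
    using that i by (simp add: d_def p0_def c_def of_nat_diff)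
  have d_sum: "(\<Sum>r<i. d p r) = c * int i" if "p \<in> Q" for p
  proof -
    have "(\<Sum>r<i. int (q r)) = (\<Sum>r<i. int r)" if "q \<in> Q" for q
      using sum.permute[of q "{0..<i}" int] that by (simp add: Q_def atLeast0LessThan comp_def)
    then have "(\<Sum>r<i. d p r) = (\<Sum>r<i. d p0 r)"
      using that p0 by (simp add: d_def sum_subtractf)
    then show ?thesis
      using d_p0 by simp
  qed
  have higher: "mon p \<in> higher ht2 (mon p0)" if p: "p \<in> Q" "p \<noteq> p0" for p
  proof -
    obtain r where r: "p r \<noteq> p0 r"
      using p(2) by blast
    then have "r < i"
      using p(1) by (cases "r < i") (simp_all add: Q_def p0_def permutes_def)
    moreover have "d p r \<noteq> c"
      using r d_p0[OF \<open>r < i\<close>] by (auto simp: d_def)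
    ultimately have "0 < (\<Sum>r<i. (d p r - c)^2)"
      by (intro sum_pos2[of _ r]) auto
    also have "\<dots> = (\<Sum>r<i. (d p r)^2) - 2 * c * (\<Sum>r<i. d p r) + int i * c^2"
      by (simp add: power2_diff sum.distrib sum_subtractf sum_distrib_left algebra_simps)
    also have "\<dots> = (\<Sum>r<i. (d p r)^2) - (\<Sum>r<i. (d p0 r)^2)"
      using d_sum[OF p(1)] d_p0 by (simp add: power2_eq_square)
    finally show ?thesis
      using wgt_mon[OF p(1)] wgt_mon[OF p0] deg[of p] deg[of p0] by (simp add: higher_def)
  qed
  have "minor n i = Poly_Mapping.single (mon p0) (signof p0) +
      (\<Sum>p\<in>Q - {p0}. Poly_Mapping.single (mon p) (signof p))"
    unfolding minor using finQ p0 by (rule sum.remove)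
  moreover have "Poly_Mapping.keys (\<Sum>p\<in>Q - {p0}. Poly_Mapping.single (mon p) (signof p :: complex))
      \<subseteq> higher ht2 (mon p0)"
    using higher by (intro order.trans[OF keys_sum] UN_least) auto
  moreover have "(signof p0 :: complex) \<noteq> 0"
    by (simp add: sign_def)
  ultimately show ?thesis
    unfolding has_initial_def mon_p0[symmetric] by blast
qed

lemma minor_in:
  assumes "\<And>a b. a < i \<Longrightarrow> n + 1 - i \<le> b \<Longrightarrow> b \<le> n \<Longrightarrow> rt a b \<in> V" "2 * i \<le> n + 1"
  shows "minor n i \<in> polys_in V"
proof -
  have "(signof p :: spoly) \<in> polys_in V" for p
    by (simp add: sign_def polys_in_uminus)
  moreover have "mat i i (\<lambda>(r, s). Var (rt s (n - r))) $$ (r, p r) \<in> polys_in V"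
    if "p permutes {0..<i}" "r \<in> {0..<i}" for p r
    using that permutes_in_image[OF that(1), of r] assms by auto
  ultimately show ?thesis
    unfolding minor_def det_def by (auto intro!: polys_in_sum polys_in_mult polys_in_prod)
qed

lemma Sym_eq: "Sym n N = polys_in (roots_of n N)"
  by (simp add: Sym_def polys_in_def)

text \<open>The condition \<open>block\<close> makes the minors polynomials in the variables from
  \<open>V\<close>; the condition \<open>hook\<close> ensures that elimination clears every variable
  of \<open>V\<close> off the antidiagonal.\<close>

locale block_roots =
  fixes n m :: nat and V :: "wt set"
  assumes m: "2 * m \<le> n + 1"
    and V_roots: "V \<subseteq> pos_roots n"
    and block: "\<And>a b. a < m \<Longrightarrow> n + 1 - m \<le> b \<Longrightarrow> b \<le> n \<Longrightarrow> rt a b \<in> V"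
    and hook: "\<And>a b. a < b \<Longrightarrow> rt a b \<in> V \<Longrightarrow> b \<le> n \<and> (a < m \<or> n + 1 - m \<le> b)"
begin

sublocale disjoint_initials V ht2 "{0<..m}" "diag_roots n" "minor n"
proof
  show "finite V"
    using V_roots finite_pos_roots finite_subset by blast
  fix i assume i: "i \<in> {0<..m}"
  show "diag_roots n i \<noteq> {}"
    using i by (auto simp: diag_roots_def lessThan_empty_iff)
  show "diag_roots n i \<subseteq> V"
    using i m by (auto simp: diag_roots_def intro!: block)
  show "minor n i \<in> polys_in V"
    using i m by (intro minor_in block) auto
  show "has_initial ht2 (\<Sum>x\<in>diag_roots n i. Poly_Mapping.single x 1) (minor n i)"
    using i m by (intro has_initial_minor) auto
  fix j assume j: "j \<in> {0<..m}" "i \<noteq> j"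
  \<comment> \<open>Diagonals of different minors consist of roots of different heights.\<close>
  have "rt s (n + 1 - i + s) \<noteq> rt t (n + 1 - j + t)" if "s < i" "t < j" for s t
    using that i j m by (subst rt_inj) auto
  then show "diag_roots n i \<inter> diag_roots n j = {}"
    by (auto simp: diag_roots_def)
qed simp

section \<open>Every invariant is a polynomial in the corner minors\<close>

definition inv_polys :: "spoly set" where
  "inv_polys = {p \<in> polys_in V. \<forall>g\<in>unip n. act n g p = p}"

lemma inv_polys_iff:
  "p \<in> inv_polys \<longleftrightarrow> p \<in> polys_in V \<and> (\<forall>g\<in>unip n. \<forall>v. pev (pull n g v) p = pev v p)"
  unfolding inv_polys_def by (auto simp flip: pev_act intro: poly_eqI_pev)

lemma G_inv: "G \<subseteq> inv_polys"
proof
  fix p assume "p \<in> G"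
  then obtain Y c where p: "p = (\<Sum>e\<in>Y. Cst (c e) * fpow e)"
    by (auto simp: G_def comb_def)
  have "pev (pull n g v) (minor n i) = pev v (minor n i)" if "g \<in> unip n" "i \<in> {0<..m}" for g v i
    using that m unitri_unip by (intro pev_minor_pull) auto
  then have "pev (pull n g v) p = pev v p" if "g \<in> unip n" for g v
    using that by (simp add: p fpow_def pev_sum pev_mult pev_prod pev_power)
  then show "p \<in> inv_polys"
    using \<open>p \<in> G\<close> G_subset by (auto simp: inv_polys_iff)
qed

definition regular :: "(wt \<Rightarrow> complex) \<Rightarrow> bool" where
  "regular v \<longleftrightarrow> (\<forall>i\<in>{0<..m}. pev v (minor n i) \<noteq> 0)"

definition disc :: spoly where
  "disc = (\<Prod>i\<in>{0<..m}. minor n i)"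

text \<open>Such functions agree at regular points with an element of the localisation of
  \<open>G\<close> at \<open>disc\<close>.\<close>

definition rational :: "((wt \<Rightarrow> complex) \<Rightarrow> complex) \<Rightarrow> bool" where
  "rational \<phi> \<longleftrightarrow> (\<exists>k. \<exists>q\<in>G. \<forall>v. regular v \<longrightarrow> pev v disc ^ k * \<phi> v = pev v q)"

lemma disc_G: "disc \<in> G"
  unfolding disc_def by (intro G_prod f_in_G)

lemma regular_disc: "regular v \<longleftrightarrow> pev v disc \<noteq> 0"
  by (auto simp: regular_def disc_def pev_prod)

lemma rational_G: "q \<in> G \<Longrightarrow> rational (\<lambda>v. pev v q)"
  unfolding rational_def by (rule exI[of _ 0]) auto

lemma rational_const: "rational (\<lambda>_. c)"
  using rational_G[OF G_Cst] by simp

lemma rational_mult: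
  assumes "rational \<phi>" "rational \<psi>"
  shows "rational (\<lambda>v. \<phi> v * \<psi> v)"
proof -
  obtain k q where q: "q \<in> G" "\<And>v. regular v \<Longrightarrow> pev v disc ^ k * \<phi> v = pev v q"
    using assms(1) by (auto simp: rational_def)
  obtain l r where r: "r \<in> G" "\<And>v. regular v \<Longrightarrow> pev v disc ^ l * \<psi> v = pev v r"
    using assms(2) by (auto simp: rational_def)
  have "pev v disc ^ (k + l) * (\<phi> v * \<psi> v) = pev v (q * r)" if "regular v" for v
    using q(2)[OF that] r(2)[OF that] by (simp add: pev_mult power_add flip: q(2)[OF that] r(2)[OF that])
  then show ?thesis
    unfolding rational_def using G_mult[OF q(1) r(1)] by blast
qed

lemma rational_add:
  assumes "rational \<phi>" "rational \<psi>"
  shows "rational (\<lambda>v. \<phi> v + \<psi> v)"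
proof -
  obtain k q where q: "q \<in> G" "\<And>v. regular v \<Longrightarrow> pev v disc ^ k * \<phi> v = pev v q"
    using assms(1) by (auto simp: rational_def)
  obtain l r where r: "r \<in> G" "\<And>v. regular v \<Longrightarrow> pev v disc ^ l * \<psi> v = pev v r"
    using assms(2) by (auto simp: rational_def)
  have "pev v disc ^ (k + l) * (\<phi> v + \<psi> v) = pev v (disc ^ l * q + disc ^ k * r)" if "regular v" for v
    by (simp add: pev_mult pev_add pev_power power_add algebra_simps flip: q(2)[OF that] r(2)[OF that])
  moreover have "disc ^ l * q + disc ^ k * r \<in> G"
    by (intro G_add G_mult G_power disc_G q(1) r(1))
  ultimately show ?thesis
    unfolding rational_def by blast
qed

lemma rational_sum: "(\<And>x. x \<in> Y \<Longrightarrow> rational (\<phi> x)) \<Longrightarrow> rational (\<lambda>v. \<Sum>x\<in>Y. \<phi> x v)"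
  by (induction Y rule: infinite_finite_induct) (auto intro: rational_add rational_const)

lemma rational_prod: "(\<And>x. x \<in> Y \<Longrightarrow> rational (\<phi> x)) \<Longrightarrow> rational (\<lambda>v. \<Prod>x\<in>Y. \<phi> x v)"
  by (induction Y rule: infinite_finite_induct) (auto intro: rational_mult rational_const)

lemma rational_power: "rational \<phi> \<Longrightarrow> rational (\<lambda>v. \<phi> v ^ k)"
  by (induction k) (auto intro: rational_mult rational_const)

text \<open>Applied to \<open>slice\<close>, this makes the value of an invariant a rational
  function of the minors.\<close>

lemma rational_pev: "(\<And>x. rational (\<lambda>v. u v x)) \<Longrightarrow> rational (\<lambda>v. pev (u v) p)"
  unfolding pev_def mon_eval_def by (intro rational_sum rational_mult rational_const rational_prod rational_power)

lemma rational_inverse_minor: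
  assumes "i \<in> {0<..m}"
  shows "rational (\<lambda>v. 1 / pev v (minor n i))"
proof -
  define q where "q = (\<Prod>j\<in>{0<..m} - {i}. minor n j)"
  have "disc = minor n i * q"
    unfolding disc_def q_def using assms by (intro prod.remove) auto
  then have "pev v disc ^ 1 * (1 / pev v (minor n i)) = pev v q" if "regular v" for v
    using that assms by (simp add: regular_def pev_mult)
  moreover have "q \<in> G"
    unfolding q_def by (intro G_prod f_in_G) auto
  ultimately show ?thesis
    unfolding rational_def by blast
qed

text \<open>The empty minor starts the chain of quotients in \<open>slice\<close>, so the first
  entry needs no separate formula.\<close>

lemma minor_0: "minor n 0 = 1"
  by (simp add: minor_def det_def)

text \<open>The antidiagonal point in the orbit of \<open>v\<close>.\<close>

definition slice :: "(wt \<Rightarrow> complex) \<Rightarrow> wt \<Rightarrow> complex" where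
  "slice v \<gamma> = (\<Sum>r<m. if \<gamma> = rt r (n - r) then pev v (minor n (r + 1)) * (1 / pev v (minor n r)) else 0)"

lemma rational_slice: "rational (\<lambda>v. slice v \<gamma>)"
proof -
  have "rational (\<lambda>v. if \<gamma> = rt r (n - r) then pev v (minor n (r + 1)) * (1 / pev v (minor n r)) else 0)"
    if r: "r \<in> {..<m}" for r
  proof (cases "\<gamma> = rt r (n - r)")
    case True
    have "rational (\<lambda>v. 1 / pev v (minor n r))"
      using rational_inverse_minor[of r] rational_const[of 1] r by (cases r) (auto simp: minor_0)
    moreover have "rational (\<lambda>v. pev v (minor n (r + 1)))"
      using r by (intro rational_G f_in_G) auto
    ultimately show ?thesis
      unfolding if_P[OF True] by (intro rational_mult)
  next
    case False
    show ?thesis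
      unfolding if_not_P[OF False] by (rule rational_const)
  qed
  then show ?thesis
    unfolding slice_def by (rule rational_sum)
qed

text \<open>Elimination leads from \<open>v\<close> to a clean point \<open>v'\<close> at which
  invariants take the same values. There each minor is a product of antidiagonal entries, so these
  entries are quotients of consecutive minors. The points \<open>v'\<close> and
  \<open>slice v\<close> may differ outside \<open>V\<close>, which \<open>p\<close> does not
  see.\<close>

lemma inv_eval_slice:
  assumes "p \<in> inv_polys" "regular v"
  shows "pev v p = pev (slice v) p"
proof -
  obtain v' where v': "clean n m v'" "same_inv n v v'"
    using clean_exists[OF m, of v] assms(2) by (auto simp: regular_def)
  define c where "c r = v' (rt r (n - r))" for r
  have minors: "pev v (minor n i) = (\<Prod>r<i. c r)" if "i \<le> m" for i
  proof -
    have "2 * i \<le> n + 1"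
      using that m by linarith
    then have "pev v (minor n i) = pev v' (minor n i)"
      using v'(2) act_minor[of _ n i] by (simp add: same_inv_def)
    then show ?thesis
      using minor_clean[OF v'(1), of i] that \<open>2 * i \<le> n + 1\<close> by (simp add: c_def)
  qed
  have quotient: "pev v (minor n (r + 1)) * (1 / pev v (minor n r)) = c r" if "r < m" for r
  proof -
    have "pev v (minor n r) \<noteq> 0"
      using that assms(2) by (cases "r = 0") (auto simp: regular_def minor_0)
    then show ?thesis
      using minors[of r] minors[of "r + 1"] that by simp
  qed
  have slice: "slice v \<gamma> = (\<Sum>r<m. if \<gamma> = rt r (n - r) then c r else 0)" for \<gamma>
    unfolding slice_def using quotient by (intro sum.cong) auto
  have "slice v x = v' x" if x: "x \<in> V" for x
  proof -
    obtain a b where ab: "x = rt a b" "a < b" "b \<le> n"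
      using x V_roots by (auto simp: pos_roots_eq)
    \<comment> \<open>Off the antidiagonal \<open>v'\<close> is known to vanish only in the first
      \<open>m\<close> rows and the last \<open>m\<close> columns, and \<open>V\<close> lies
      there.\<close>
    then have hk: "a < m \<or> n - m < b"
      using hook[of a b] x m by auto
    have "slice v x = (\<Sum>r<m. if r = a then (if b = n - a then c a else 0) else 0)"
      unfolding slice ab(1) using ab(2) by (intro sum.cong) (auto simp: rt_inj)
    also have "\<dots> = v' x"
    proof (cases "a + b = n")
      case True
      then have "a < m" "b = n - a"
        using hk ab m by auto
      then show ?thesis
        by (simp add: c_def ab(1))
    next
      case False
      then have "v' x = 0"
        using v'(1) hk ab by (simp add: clean_def)
      then show ?thesis
        using False ab by auto
    qed
    finally show ?thesis .
  qed
  then have "pev (slice v) p = pev v' p"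
    using assms(1) by (intro pev_cong) (auto simp: inv_polys_def polys_in_def)
  then show ?thesis
    using v'(2) assms(1) by (simp add: same_inv_def inv_polys_def)
qed

lemma disc_nonzero: "disc \<noteq> 0"
proof -
  have "minor n i \<noteq> 0" if "i \<in> {0<..m}" for i
    using has_initial_lookup(1)[OF f_initial[OF that]] by auto
  then show ?thesis
    by (simp add: disc_def)
qed

text \<open>Clearing the denominators of \<open>pev (slice v) p\<close> puts a multiple of
  \<open>p\<close> by a power of \<open>disc\<close> into \<open>G\<close>; saturation then removes
  this power.\<close>

theorem inv_polys_eq: "inv_polys = G"
proof
  show "inv_polys \<subseteq> G"
  proof
    fix p assume p: "p \<in> inv_polys"
    have "rational (\<lambda>v. pev (slice v) p)"
      by (intro rational_pev rational_slice)
    then obtain k q where q: "q \<in> G" "\<And>v. regular v \<Longrightarrow> pev v disc ^ k * pev (slice v) p = pev v q"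
      by (auto simp: rational_def)
    \<comment> \<open>The equation with exponent \<open>k\<close> is known only at regular points.
      The additional factor \<open>disc\<close> makes both sides 0 at all others.\<close>
    have "disc ^ (k + 1) * p = disc * q"
    proof (rule poly_eqI_pev)
      fix v
      show "pev v (disc ^ (k + 1) * p) = pev v (disc * q)"
      proof (cases "regular v")
        case True
        then show ?thesis
          using q(2)[OF True] inv_eval_slice[OF p True] by (simp add: pev_mult pev_power)
      next
        case False
        then show ?thesis
          by (simp add: regular_disc pev_mult pev_power)
      qed
    qed
    then have "disc ^ (k + 1) * p \<in> G"
      using G_mult[OF disc_G q(1)] by (simp only:)
    moreover have "disc ^ (k + 1) \<noteq> 0"
      using disc_nonzero by simp
    ultimately show "p \<in> G"
      using p by (intro G_saturated[of p "disc ^ (k + 1)"] G_power disc_G) (auto simp: inv_polys_def)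
  qed
qed (rule G_inv)

end

theorem proposition8p4:
  fixes n :: nat and N :: "complex mat set"
  assumes "nilradical n N"
  shows "(\<exists>\<alpha>\<in>simple_roots n. nil_of n {\<alpha>} \<subseteq> N \<and> N \<subseteq> optimisation n (nil_of n {\<alpha>})) \<and>
         free_over (Sym_inv n N) (Sym n N)"
proof -
  obtain K where K: "K \<subseteq> {1..n}" "K \<noteq> {}" "N = nil_of n (simple_root ` K)"
    using assms by (rule nilradical_obtain)
  \<comment> \<open>The most central simple root serves both claims: it gives the inclusions, and
    its distance \<open>m\<close> from the nearer end is the number of generating minors.\<close>
  obtain k where k: "k \<in> K" "\<And>j. j \<in> K \<Longrightarrow> min j (n + 1 - j) \<le> min k (n + 1 - k)"
    using exists_central[OF K(1,2)] by blast
  define m where "m = min k (n + 1 - k)"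
  interpret block_roots n m "nil_roots n K"
  proof
    show "2 * m \<le> n + 1"
      unfolding m_def by linarith
    show "nil_roots n K \<subseteq> pos_roots n"
      by (auto simp: nil_roots_def pos_roots_eq)
  qed (use nil_roots_between[OF K(1) k m_def] in blast)+
  have Sym: "Sym n N = polys_in (nil_roots n K)"
    by (simp add: Sym_eq K(3) roots_of_nil_of[OF K(1)])
  then have "Sym_inv n N = G"
    unfolding inv_polys_eq[symmetric] by (simp add: Sym_inv_def inv_polys_def)
  moreover have "simple_root k \<in> simple_roots n"
    using K(1) k(1) by (auto simp: simple_roots_def)
  ultimately show ?thesis
    using free_over_G nil_of_between[OF K(1) k] by (auto simp: Sym simp flip: K(3))
qed

end
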